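(* $\langle\mathcal{M}\rangle_\omega\subsetneq\mathcal{SDP}$.
   Context: $\mathcal{B}_k$ is the set of functions $\{0,1\}^k\to\mathbb{R}_{\ge0}$, $\mathcal{B}=\bigcup_k\mathcal{B}_k$; $|\mathbf{x}|$ Hamming weight, $\overline{\mathbf{x}}$ complement. $\mathrm{EQ}$ is the binary equality indicator. $\langle\mathcal{F}\rangle$ is the closure of $\mathcal{F}\cup\{\mathrm{EQ}\}$ under introducing fictitious arguments, permuting arguments, pointwise product of equal-arity functions, and summing out an argument over $\{0,1\}$; a $k$-ary $f$ is a limit of $\mathcal{F}$ if there is a finite $S\subseteq\mathcal{F}$ such that for all $\epsilon>0$ some $k$-ary $f_\epsilon\in\langle S\rangle$ has $\max_\mathbf{x}|f-f_\epsilon|<\epsilon$; $\langle\mathcal{F}\rangle_\omega$ is the closure of $\mathcal{F}\cup\{\mathrm{EQ}\}$ under the four operations and limits. Fourier transform: $\widehat f(\mathbf{x})=2^{-k}\sum_{\mathbf{w}}(-1)^{|\mathbf{w}\wedge\mathbf{x}|}f(\mathbf{w})$. An arity-$k$ match-circuit is an undirected graph with external degree-1 vertices $u_1,\dots,u_k$ whose incident edges $y_1,\dots,y_k$ (terminals) have weight 1, internal vertices $v_1,\dots,v_n$ ($n\ge k$), and weights $w_e>0$ on other edges; it implements $f(y_1,\dots,y_k)=\sum_H\prod_{e\in H}w_e$ over edge sets $H$ containing exactly the terminals set to 1 in which each internal vertex lies in exactly one edge. $\mathcal{M}=\{f\in\mathcal{B}:\widehat f$ is implemented by a match-circuit$\}$.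 $\mathcal{SDP}$ is the set of $f\in\mathcal{B}$ with $f(\mathbf{x})=f(\overline{\mathbf{x}})$ for all $\mathbf{x}$, $\widehat f(\mathbf{x})\ge0$ for all $\mathbf{x}$, and $\widehat f(\mathbf{x})\le0$ for all odd-weight $\mathbf{x}$. *)

theory Defs
  imports Complex_Main "HOL.Hull" "HOL-Library.FuncSet" "HOL-Combinatorics.Permutations"
begin

section \<open>Functions on the Boolean domain\<close>

definition cube :: "nat \<Rightarrow> bool list set" where
  "cube k = {x. length x = k}"

definition weight :: "bool list \<Rightarrow> nat" where
  "weight x = count_list x True"

text \<open>
  A \<open>k\<close>-ary function is represented by the pair of its arity and a map that is
  \<^const>\<open>extensional\<close> on \<open>{0,1}\<^sup>k\<close>, so that equality of pairs is equality of functions.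
  Nullary functions (\<open>k = 0\<close>) are included.
\<close>

type_synonym bfun = "nat \<times> (bool list \<Rightarrow> real)"

definition \<B> :: "bfun set" where
  "\<B> = {(k, f). f \<in> cube k \<rightarrow>\<^sub>E {0..}}"

definition EQ :: bfun where
  "EQ = (2, \<lambda>x\<in>cube 2. if x ! 0 = x ! 1 then 1 else 0)"

section \<open>Functional clones and \<open>\<omega>\<close>-clones\<close>

text \<open>Arguments are numbered from 0; \<open>i\<close> is the position of the argument added or summed out.\<close>

definition fictitious :: "nat \<Rightarrow> bfun \<Rightarrow> bfun" where
  "fictitious i = (\<lambda>(k, f). (Suc k, \<lambda>x\<in>cube (Suc k). f (take i x @ drop (Suc i) x)))"

definition permute_args :: "(nat \<Rightarrow> nat) \<Rightarrow> bfun \<Rightarrow> bfun" where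
  "permute_args \<pi> = (\<lambda>(k, f). (k, \<lambda>x\<in>cube k. f (permute_list \<pi> x)))"

definition sum_out :: "nat \<Rightarrow> bfun \<Rightarrow> bfun" where
  "sum_out i = (\<lambda>(k, f). (k - 1, \<lambda>x\<in>cube (k - 1). \<Sum>b\<in>UNIV. f (take i x @ b # drop i x)))"

definition closed_under_operations :: "bfun set \<Rightarrow> bool" where
  "closed_under_operations G \<longleftrightarrow>
     (\<forall>(k, f)\<in>G. \<forall>i\<le>k. fictitious i (k, f) \<in> G) \<and>
     (\<forall>(k, f)\<in>G. \<forall>\<pi>. \<pi> permutes {..<k} \<longrightarrow> permute_args \<pi> (k, f) \<in> G) \<and>
     (\<forall>k f g. (k, f) \<in> G \<longrightarrow> (k, g) \<in> G \<longrightarrow> (k, \<lambda>x\<in>cube k. f x * g x) \<in> G) \<and>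
     (\<forall>(k, f)\<in>G. \<forall>i<k. sum_out i (k, f) \<in> G)"

definition clone :: "bfun set \<Rightarrow> bfun set"  (\<open>\<langle>_\<rangle>\<close>) where
  "\<langle>F\<rangle> = closed_under_operations hull (F \<union> {EQ})"

definition limit_of :: "bfun set \<Rightarrow> bfun \<Rightarrow> bool" where
  "limit_of F = (\<lambda>(k, f). (k, f) \<in> \<B> \<and>
     (\<exists>S\<subseteq>F. finite S \<and>
        (\<forall>\<epsilon>>0. \<exists>g. (k, g) \<in> \<langle>S\<rangle> \<and> Max ((\<lambda>x. \<bar>f x - g x\<bar>) ` cube k) < \<epsilon>)))"

definition closed_under_limits :: "bfun set \<Rightarrow> bool" where
  "closed_under_limits G \<longleftrightarrow> (\<forall>h. limit_of G h \<longrightarrow> h \<in> G)"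

definition omega_clone :: "bfun set \<Rightarrow> bfun set"  (\<open>\<langle>_\<rangle>\<^sub>\<omega>\<close>) where
  "\<langle>F\<rangle>\<^sub>\<omega> = (\<lambda>G. closed_under_operations G \<and> closed_under_limits G) hull (F \<union> {EQ})"

lemma limit_of_mono:
  assumes "limit_of F h" and "F \<subseteq> G"
  shows "limit_of G h"
proof -
  have "\<exists>S\<subseteq>G. P S" if "\<exists>S\<subseteq>F. P S" for P
    using that assms(2) by blast
  then show ?thesis
    using assms(1) unfolding limit_of_def split_beta by simp
qed

lemma closed_under_operations_Inter:
  assumes "\<And>G. G \<in> \<G> \<Longrightarrow> closed_under_operations G"
  shows "closed_under_operations (\<Inter>\<G>)"
  unfolding closed_under_operations_def
proof (intro conjI)
  show "\<forall>(k, f)\<in>\<Inter>\<G>. \<forall>i\<le>k. fictitious i (k, f) \<in> \<Inter>\<G>"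
    using assms unfolding closed_under_operations_def by blast
  show "\<forall>(k, f)\<in>\<Inter>\<G>. \<forall>\<pi>. \<pi> permutes {..<k} \<longrightarrow> permute_args \<pi> (k, f) \<in> \<Inter>\<G>"
    using assms unfolding closed_under_operations_def by blast
  show "\<forall>k f g. (k, f) \<in> \<Inter>\<G> \<longrightarrow> (k, g) \<in> \<Inter>\<G> \<longrightarrow> (k, \<lambda>x\<in>cube k. f x * g x) \<in> \<Inter>\<G>"
    using assms unfolding closed_under_operations_def by blast
  show "\<forall>(k, f)\<in>\<Inter>\<G>. \<forall>i<k. sum_out i (k, f) \<in> \<Inter>\<G>"
    using assms unfolding closed_under_operations_def by blast
qed

lemma closed_under_limits_Inter:
  assumes "\<And>G. G \<in> \<G> \<Longrightarrow> closed_under_limits G"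
  shows "closed_under_limits (\<Inter>\<G>)"
  using assms limit_of_mono[of "\<Inter>\<G>"] unfolding closed_under_limits_def by blast

lemma closed_under_operations_clone: "closed_under_operations \<langle>F\<rangle>"
  unfolding clone_def by (rule hull_in) (simp add: closed_under_operations_Inter)

lemma closed_omega_clone:
  "closed_under_operations \<langle>F\<rangle>\<^sub>\<omega> \<and> closed_under_limits \<langle>F\<rangle>\<^sub>\<omega>"
  unfolding omega_clone_def
  by (rule hull_in) (simp add: closed_under_operations_Inter closed_under_limits_Inter)

section \<open>Fourier transform\<close>

definition fourier :: "nat \<Rightarrow> (bool list \<Rightarrow> real) \<Rightarrow> bool list \<Rightarrow> real" where
  "fourier k f x = (1 / 2 ^ k) * (\<Sum>w\<in>cube k. (- 1) ^ weight (map2 (\<and>) w x) * f w)"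

section \<open>Match-circuits\<close>

datatype vertex = External nat | Internal nat

text \<open>
  Graphs are simple and loopless: an edge is a two-element set of vertices.
  The vertices are \<open>External i\<close> for \<open>i < k\<close> and \<open>Internal j\<close> for \<open>j < n\<close>.
\<close>

definition terminal :: "vertex set set \<Rightarrow> nat \<Rightarrow> vertex set" where
  "terminal E i = (THE e. e \<in> E \<and> External i \<in> e)"

definition match_circuit ::
    "nat \<Rightarrow> nat \<Rightarrow> vertex set set \<Rightarrow> (vertex set \<Rightarrow> real) \<Rightarrow> bool" where
  "match_circuit k n E wt \<longleftrightarrow>
     k \<le> n \<and>
     (\<forall>e\<in>E. e \<subseteq> External ` {..<k} \<union> Internal ` {..<n} \<and> card e = 2) \<and>
     (\<forall>i<k. \<exists>!e. e \<in> E \<and> External i \<in> e) \<and>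
     (\<forall>i<k. wt (terminal E i) = 1) \<and>
     (\<forall>e\<in>E - terminal E ` {..<k}. wt e > 0)"

definition circuit_value ::
    "nat \<Rightarrow> nat \<Rightarrow> vertex set set \<Rightarrow> (vertex set \<Rightarrow> real) \<Rightarrow> bool list \<Rightarrow> real" where
  "circuit_value k n E wt y =
     (\<Sum>H | H \<subseteq> E \<and> (\<forall>i<k. terminal E i \<in> H \<longleftrightarrow> y ! i) \<and>
            (\<forall>j<n. \<exists>!e. e \<in> H \<and> Internal j \<in> e). \<Prod>e\<in>H. wt e)"

definition implemented :: "nat \<Rightarrow> (bool list \<Rightarrow> real) \<Rightarrow> bool" where
  "implemented k f \<longleftrightarrow>
     (\<exists>n E wt. match_circuit k n E wt \<and> (\<forall>y\<in>cube k. f y = circuit_value k n E wt y))"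

section \<open>The classes \<open>\<M>\<close> and \<open>SDP\<close>\<close>

definition \<M> :: "bfun set" where
  "\<M> = {(k, f). (k, f) \<in> \<B> \<and> implemented k (fourier k f)}"

definition SDP :: "bfun set" where
  "SDP = {(k, f). (k, f) \<in> \<B> \<and>
     (\<forall>x\<in>cube k. f x = f (map Not x)) \<and>
     (\<forall>x\<in>cube k. fourier k f x \<ge> 0) \<and>
     (\<forall>x\<in>cube k. odd (weight x) \<longrightarrow> fourier k f x \<le> 0)}"

end

theory Submission
  imports Defs
begin

text \<open>
  Write bits as spins \<open>\<sigma>\<^sub>a, \<tau>\<^sub>a = \<plusminus>1\<close>. The invariant separating the two classes is Ginibre's:
  \<open>f(\<sigma>) f(\<tau>)\<close> is a limit of nonnegative combinations of products of the factors
  \<open>\<sigma>\<^sub>a \<tau>\<^sub>a\<close> and \<open>\<sigma>\<^sub>a \<sigma>\<^sub>b + \<tau>\<^sub>a \<tau>\<^sub>b\<close>. Such combinations are closed under multiplication, and under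
  summation over \<open>\<sigma>\<^sub>v, \<tau>\<^sub>v\<close>, because two factors meeting at \<open>v\<close> can be merged:
  \<open>(\<sigma>\<^sub>v \<sigma>\<^sub>a + \<tau>\<^sub>v \<tau>\<^sub>a) (\<sigma>\<^sub>v \<sigma>\<^sub>b + \<tau>\<^sub>v \<tau>\<^sub>b) = (\<sigma>\<^sub>a \<sigma>\<^sub>b + \<tau>\<^sub>a \<tau>\<^sub>b) (1 + \<sigma>\<^sub>v \<tau>\<^sub>v \<sigma>\<^sub>a \<tau>\<^sub>a)\<close>.
  So the invariant defines an \<open>\<omega>\<close>-clone. It implies membership in \<open>SDP\<close>: summing over
  \<open>\<tau>\<close> shows that the Fourier coefficients of \<open>f\<close>, times its total mass, are nonnegative, and zero in odd
  degree. The inverse Fourier transform of a match-circuit has the invariant since perfect matchings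
  are the leading term, as \<open>\<epsilon> \<rightarrow> 0\<close>, of subgraphs with odd degree at all internal vertices when an
  edge gets a factor \<open>\<epsilon>\<close> per internal endpoint; the latter are generated by a ferromagnetic Ising
  model with weights \<open>1 + w\<^sub>e \<sigma>\<^sub>u \<sigma>\<^sub>v\<close>, and \<open>(1 + w \<sigma>\<^sub>u \<sigma>\<^sub>v) (1 + w \<tau>\<^sub>u \<tau>\<^sub>v)\<close> has the required form.
  Finally the 4-ary even parity function lies in \<open>SDP\<close> but violates an inequality implied by the
  invariant.
\<close>

section \<open>The Ginibre cone\<close>

definition spin :: "bool \<Rightarrow> real" where
  "spin b = (if b then - 1 else 1)"

lemma spin_simps [simp]: "spin True = - 1" "spin False = 1" "spin b * spin b = 1"
  "spin b * (spin b * z) = z" "spin (\<not> b) = - spin b"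
  by (auto simp: spin_def)

definition overlap :: "'v \<Rightarrow> ('v \<Rightarrow> bool) \<Rightarrow> ('v \<Rightarrow> bool) \<Rightarrow> real" where
  "overlap a \<sigma> \<tau> = spin (\<sigma> a) * spin (\<tau> a)"

definition bond :: "'v \<times> 'v \<Rightarrow> ('v \<Rightarrow> bool) \<Rightarrow> ('v \<Rightarrow> bool) \<Rightarrow> real" where
  "bond p \<sigma> \<tau> = spin (\<sigma> (fst p)) * spin (\<sigma> (snd p)) + spin (\<tau> (fst p)) * spin (\<tau> (snd p))"

text \<open>Lists serve as multisets: factors may repeat, and the product of two monomials is the
  monomial of the concatenated lists. Repetitions are reduced only when a spin is
  eliminated.\<close>

definition ginibre_monomial ::
    "'v list \<Rightarrow> ('v \<times> 'v) list \<Rightarrow> ('v \<Rightarrow> bool) \<Rightarrow> ('v \<Rightarrow> bool) \<Rightarrow> real" where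
  "ginibre_monomial xs ps \<sigma> \<tau> = (\<Prod>a\<leftarrow>xs. overlap a \<sigma> \<tau>) * (\<Prod>p\<leftarrow>ps. bond p \<sigma> \<tau>)"

inductive ginibre_cone ::
    "'v set \<Rightarrow> (('v \<Rightarrow> bool) \<Rightarrow> ('v \<Rightarrow> bool) \<Rightarrow> real) \<Rightarrow> bool" for V where
  monomial: "0 \<le> c \<Longrightarrow> set xs \<subseteq> V \<Longrightarrow> set ps \<subseteq> V \<times> V \<Longrightarrow>
    ginibre_cone V (\<lambda>\<sigma> \<tau>. c * ginibre_monomial xs ps \<sigma> \<tau>)"
| add: "ginibre_cone V K \<Longrightarrow> ginibre_cone V L \<Longrightarrow> ginibre_cone V (\<lambda>\<sigma> \<tau>. K \<sigma> \<tau> + L \<sigma> \<tau>)"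

lemma ginibre_cone_const: "0 \<le> c \<Longrightarrow> ginibre_cone V (\<lambda>\<sigma> \<tau>. c)"
  using ginibre_cone.monomial[of c "[]" V "[]"] by (simp add: ginibre_monomial_def)

lemma ginibre_cone_overlap: "a \<in> V \<Longrightarrow> ginibre_cone V (overlap a)"
  using ginibre_cone.monomial[of 1 "[a]" V "[]"] by (simp add: ginibre_monomial_def)

lemma ginibre_cone_bond: "fst p \<in> V \<Longrightarrow> snd p \<in> V \<Longrightarrow> ginibre_cone V (bond p)"
  using ginibre_cone.monomial[of 1 "[]" V "[p]"] by (cases p) (simp add: ginibre_monomial_def)

lemma ginibre_cone_mult:
  assumes "ginibre_cone V K" and "ginibre_cone V L"
  shows "ginibre_cone V (\<lambda>\<sigma> \<tau>. K \<sigma> \<tau> * L \<sigma> \<tau>)"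
  using assms(1)
proof (induction rule: ginibre_cone.induct)
  case (monomial c xs ps)
  show ?case
    using assms(2)
  proof (induction rule: ginibre_cone.induct)
    case (monomial d ys qs)
    then show ?case
      using ginibre_cone.monomial[of "c * d" "xs @ ys" V "ps @ qs"]
        \<open>0 \<le> c\<close> \<open>set xs \<subseteq> V\<close> \<open>set ps \<subseteq> V \<times> V\<close>
      by (simp add: ginibre_monomial_def mult_ac)
  next
    case (add K L)
    from ginibre_cone.add[OF add.IH] show ?case by (simp add: distrib_left)
  qed
next
  case (add K L)
  from ginibre_cone.add[OF add.IH] show ?case by (simp add: distrib_right)
qed

lemma ginibre_cone_prod:
  assumes "\<And>i. i \<in> I \<Longrightarrow> ginibre_cone V (K i)"
  shows "ginibre_cone V (\<lambda>\<sigma> \<tau>. \<Prod>i\<in>I. K i \<sigma> \<tau>)"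
  using assms
  by (induction I rule: infinite_finite_induct)
    (auto intro: ginibre_cone_const ginibre_cone_mult)

text \<open>Only labels in \<open>V\<close> occur in the factors. This allows kernels to be
  evaluated at \<open>(!) x\<close>, whose values beyond the length of \<open>x\<close> are
  unspecified.\<close>

lemma ginibre_cone_cong:
  assumes "ginibre_cone V K" and "\<And>v. v \<in> V \<Longrightarrow> \<sigma> v = \<sigma>' v \<and> \<tau> v = \<tau>' v"
  shows "K \<sigma> \<tau> = K \<sigma>' \<tau>'"
  using assms(1)
proof (induction rule: ginibre_cone.induct)
  case (monomial c xs ps)
  have "map (\<lambda>a. overlap a \<sigma> \<tau>) xs = map (\<lambda>a. overlap a \<sigma>' \<tau>') xs"
    using monomial assms(2) by (auto simp: overlap_def)
  moreover have "map (\<lambda>p. bond p \<sigma> \<tau>) ps = map (\<lambda>p. bond p \<sigma>' \<tau>') ps"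
    using monomial assms(2) by (force simp: bond_def)
  ultimately show ?case
    unfolding ginibre_monomial_def by presburger
qed simp

lemma ginibre_cone_rename:
  assumes "ginibre_cone V K" and "h ` V \<subseteq> U"
  shows "ginibre_cone U (\<lambda>\<sigma> \<tau>. K (\<lambda>v. \<sigma> (h v)) (\<lambda>v. \<tau> (h v)))"
  using assms(1)
proof (induction rule: ginibre_cone.induct)
  case (monomial c xs ps)
  then show ?case
    using ginibre_cone.monomial[of c "map h xs" U "map (map_prod h h) ps"] assms(2)
    by (fastforce simp: ginibre_monomial_def overlap_def bond_def o_def)
next
  case (add K L)
  from ginibre_cone.add[OF add.IH] show ?case .
qed

text \<open>
  Elements of the cone over \<open>insert v V\<close>, reduced to degree at most one in the spins at \<open>v\<close>.
\<close>

inductive ginibre_normal ::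
    "'v set \<Rightarrow> 'v \<Rightarrow> (('v \<Rightarrow> bool) \<Rightarrow> ('v \<Rightarrow> bool) \<Rightarrow> real) \<Rightarrow> bool" for V v where
  free: "ginibre_cone V K \<Longrightarrow> ginibre_normal V v K"
| overlap: "ginibre_cone V K \<Longrightarrow> ginibre_normal V v (\<lambda>\<sigma> \<tau>. overlap v \<sigma> \<tau> * K \<sigma> \<tau>)"
| bond: "ginibre_cone V K \<Longrightarrow> b \<in> V \<Longrightarrow>
    ginibre_normal V v (\<lambda>\<sigma> \<tau>. bond (v, b) \<sigma> \<tau> * K \<sigma> \<tau>)"
| add: "ginibre_normal V v K \<Longrightarrow> ginibre_normal V v L \<Longrightarrow>
    ginibre_normal V v (\<lambda>\<sigma> \<tau>. K \<sigma> \<tau> + L \<sigma> \<tau>)"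

section \<open>Elimination of one spin\<close>

lemma bond_sym: "bond (a, b) = bond (b, a)"
  by (auto simp: bond_def fun_eq_iff)

lemma bond_loop: "bond (a, a) \<sigma> \<tau> = 2"
  by (simp add: bond_def)

lemma overlap_square: "overlap a \<sigma> \<tau> * overlap a \<sigma> \<tau> = 1"
  by (simp add: overlap_def mult_ac)

text \<open>Multiplying the bond by \<open>\<sigma>\<^sub>a \<tau>\<^sub>a \<sigma>\<^sub>b
  \<tau>\<^sub>b\<close> exchanges its two summands, and overlaps square to 1. An overlap can
  therefore be moved along a bond.\<close>

lemma overlap_bond: "overlap a \<sigma> \<tau> * bond (a, b) \<sigma> \<tau> = overlap b \<sigma> \<tau> * bond (a, b) \<sigma> \<tau>"
  by (cases "\<sigma> a"; cases "\<tau> a"; cases "\<sigma> b"; cases "\<tau> b") (simp_all add: overlap_def bond_def)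

text \<open>The diagonal terms of the expansion give the bond between \<open>a\<close> and
  \<open>b\<close>. The mixed terms give \<open>\<sigma>\<^sub>v \<tau>\<^sub>v (\<sigma>\<^sub>a
  \<tau>\<^sub>b + \<tau>\<^sub>a \<sigma>\<^sub>b)\<close>, whose bracket is that bond times the
  overlap at \<open>a\<close>.\<close>

lemma bond_bond:
  "bond (v, a) \<sigma> \<tau> * bond (v, b) \<sigma> \<tau> =
    bond (a, b) \<sigma> \<tau> + overlap v \<sigma> \<tau> * (overlap a \<sigma> \<tau> * bond (a, b) \<sigma> \<tau>)"
  by (cases "\<sigma> v"; cases "\<tau> v"; cases "\<sigma> a"; cases "\<tau> a"; cases "\<sigma> b"; cases "\<tau> b")
    (simp_all add: overlap_def bond_def)

lemma ginibre_normal_mult_cone: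
  assumes "ginibre_normal V v K" and L: "ginibre_cone V L"
  shows "ginibre_normal V v (\<lambda>\<sigma> \<tau>. L \<sigma> \<tau> * K \<sigma> \<tau>)"
  using assms(1)
proof (induction rule: ginibre_normal.induct)
  case (free K)
  then show ?case using L by (intro ginibre_normal.free ginibre_cone_mult)
next
  case (overlap K)
  from ginibre_normal.overlap[OF ginibre_cone_mult[OF L overlap]] show ?case
    by (simp add: mult_ac)
next
  case (bond K b)
  from ginibre_normal.bond[OF ginibre_cone_mult[OF L bond(1)] bond(2)] show ?case
    by (simp add: mult_ac)
next
  case (add K L)
  from ginibre_normal.add[OF add.IH] show ?case by (simp add: distrib_left)
qed

lemma ginibre_normal_mult_overlap:
  assumes "ginibre_normal V v K"
  shows "ginibre_normal V v (\<lambda>\<sigma> \<tau>. overlap v \<sigma> \<tau> * K \<sigma> \<tau>)"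
  using assms
proof (induction rule: ginibre_normal.induct)
  case (free K)
  then show ?case by (rule ginibre_normal.overlap)
next
  case (overlap K)
  then show ?case
    by (simp add: mult.assoc[symmetric] overlap_square ginibre_normal.free)
next
  case (bond K b)
  \<comment> \<open>The overlap at \<open>v\<close> is moved along the bond to \<open>b\<close>,
    where it is absorbed into the cone over \<open>V\<close>.\<close>
  have "bond (v, b) \<sigma> \<tau> * (overlap b \<sigma> \<tau> * K \<sigma> \<tau>) =
      overlap v \<sigma> \<tau> * (bond (v, b) \<sigma> \<tau> * K \<sigma> \<tau>)" for \<sigma> \<tau>
    unfolding mult.assoc[symmetric] overlap_bond[of v \<sigma> \<tau> b] by (simp only: mult_ac)
  with ginibre_normal.bond[OF ginibre_cone_mult[OF ginibre_cone_overlap[OF bond(2)] bond(1)] bond(2), of v]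
  show ?case by (simp only:)
next
  case (add K L)
  from ginibre_normal.add[OF add.IH] show ?case by (simp add: distrib_left)
qed

lemma ginibre_normal_mult_bond:
  assumes "ginibre_normal V v K" and b: "b \<in> V"
  shows "ginibre_normal V v (\<lambda>\<sigma> \<tau>. bond (v, b) \<sigma> \<tau> * K \<sigma> \<tau>)"
  using assms(1)
proof (induction rule: ginibre_normal.induct)
  case (free K)
  then show ?case using b by (rule ginibre_normal.bond)
next
  case (overlap K)
  from ginibre_normal.bond[OF ginibre_cone_mult[OF ginibre_cone_overlap[OF b] overlap] b]
  have "ginibre_normal V v (\<lambda>\<sigma> \<tau>. (overlap b \<sigma> \<tau> * bond (v, b) \<sigma> \<tau>) * K \<sigma> \<tau>)"
    by (simp add: mult_ac)
  moreover have "overlap b \<sigma> \<tau> * bond (v, b) \<sigma> \<tau> * K \<sigma> \<tau> =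
      bond (v, b) \<sigma> \<tau> * (overlap v \<sigma> \<tau> * K \<sigma> \<tau>)" for \<sigma> \<tau>
    unfolding overlap_bond[of v \<sigma> \<tau> b, symmetric] by (simp only: mult_ac)
  ultimately show ?case by simp
next
  case (bond K a)
  have ab: "ginibre_cone V (\<lambda>\<sigma> \<tau>. bond (b, a) \<sigma> \<tau> * K \<sigma> \<tau>)"
    using bond b by (intro ginibre_cone_mult ginibre_cone_bond) auto
  from ginibre_normal.add[OF ginibre_normal.free[OF ab]
      ginibre_normal.overlap[OF ginibre_cone_mult[OF ginibre_cone_overlap[OF b] ab]]]
  show ?case
    by (simp add: mult.assoc[symmetric] bond_bond distrib_right)
next
  case (add K L)
  from ginibre_normal.add[OF add.IH] show ?case by (simp add: distrib_left)
qed

text \<open>Starting from the constant \<open>c\<close>, the factors of a monomial are multiplied in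
  one at a time, and each product is brought back to normal form. A loop at \<open>v\<close> is just
  the constant 2.\<close>

lemma ginibre_cone_imp_normal:
  assumes "ginibre_cone (insert v V) K"
  shows "ginibre_normal V v K"
  using assms
proof (induction rule: ginibre_cone.induct)
  case (monomial c xs ps)
  have overlap: "ginibre_normal V v (\<lambda>\<sigma> \<tau>. overlap a \<sigma> \<tau> * K \<sigma> \<tau>)"
    if "a \<in> insert v V" "ginibre_normal V v K" for a K
    using that ginibre_normal_mult_overlap[of V v K]
      ginibre_normal_mult_cone[of V v K, OF _ ginibre_cone_overlap[of a]]
    by (cases "a = v") auto
  have bond: "ginibre_normal V v (\<lambda>\<sigma> \<tau>. bond (a, b) \<sigma> \<tau> * K \<sigma> \<tau>)"
    if a: "a \<in> insert v V" and b: "b \<in> insert v V" and K: "ginibre_normal V v K" for a b K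
  proof (cases "a = v")
    case True
    show ?thesis
    proof (cases "b = v")
      case True
      then show ?thesis
        using \<open>a = v\<close> K ginibre_normal_mult_cone[OF _ ginibre_cone_const[of 2]]
        by (simp add: bond_loop)
    next
      case False
      then show ?thesis
        using \<open>a = v\<close> b K by (simp add: ginibre_normal_mult_bond)
    qed
  next
    case False
    with a have "a \<in> V" by simp
    show ?thesis
    proof (cases "b = v")
      case True
      then show ?thesis
        using \<open>a \<in> V\<close> K by (simp add: bond_sym[of a] ginibre_normal_mult_bond)
    next
      case False
      then show ?thesis
        using \<open>a \<in> V\<close> b K by (intro ginibre_normal_mult_cone ginibre_cone_bond) auto
    qed
  qed
  have bonds: "ginibre_normal V v (\<lambda>\<sigma> \<tau>. c * ginibre_monomial [] ps \<sigma> \<tau>)"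
    using monomial(3)
  proof (induction ps)
    case Nil
    show ?case
      using monomial(1) by (simp add: ginibre_monomial_def ginibre_normal.free ginibre_cone_const)
  next
    case (Cons p ps)
    then have "fst p \<in> insert v V" "snd p \<in> insert v V" and IH: "set ps \<subseteq> insert v V \<times> insert v V"
      by auto
    from bond[OF this(1,2) Cons.IH[OF IH]] show ?case
      by (simp add: ginibre_monomial_def mult_ac)
  qed
  show ?case
    using monomial(2)
  proof (induction xs)
    case Nil
    show ?case by (rule bonds)
  next
    case (Cons a xs)
    then show ?case
      using overlap[of a, OF _ Cons.IH] by (simp add: ginibre_monomial_def mult_ac)
  qed
next
  case (add K L)
  from ginibre_normal.add[OF add.IH] show ?case .
qed

text \<open>After normalisation only the free terms survive, with a factor 4. Overlap and bond terms
  are odd in the spins at \<open>v\<close> and cancel.\<close>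

lemma ginibre_cone_sum_out:
  assumes "ginibre_cone (insert v V) K" and "v \<notin> V"
  shows "ginibre_cone V (\<lambda>\<sigma> \<tau>. \<Sum>b\<in>UNIV. \<Sum>c\<in>UNIV. K (\<sigma>(v := b)) (\<tau>(v := c)))"
  using ginibre_cone_imp_normal[OF assms(1)]
proof (induction rule: ginibre_normal.induct)
  have upd: "K (\<sigma>(v := b)) (\<tau>(v := c)) = K \<sigma> \<tau>" if "ginibre_cone V K" for K \<sigma> \<tau> b c
    using that by (rule ginibre_cone_cong) (use assms(2) in auto)
  {
    case (free K)
    then show ?case
      using ginibre_cone_mult[OF ginibre_cone_const[of 4] free]
      by (simp add: upd[OF free] del: fun_upd_apply)
  next
    case (overlap K)
    then show ?case
      using ginibre_cone_const[of 0] by (simp add: upd[OF overlap] UNIV_bool overlap_def fun_upd_same del: fun_upd_apply)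
  next
    case (bond K b)
    moreover have "b \<noteq> v" using bond assms(2) by auto
    ultimately show ?case
      using ginibre_cone_const[of 0]
      by (simp add: upd[OF bond(1)] UNIV_bool bond_def fun_upd_same fun_upd_other
          distrib_right[symmetric] del: fun_upd_apply)
  next
    case (add K L)
    from ginibre_cone.add[OF add.IH] show ?case by (simp add: sum.distrib)
  }
qed

section \<open>Elimination of a finite set of spins\<close>

lemma sum_Pow_insert:
  fixes g :: "'a set \<Rightarrow> 'b::comm_monoid_add"
  assumes "finite W" and "v \<notin> W"
  shows "(\<Sum>S\<in>Pow (insert v W). g S) = (\<Sum>S\<in>Pow W. g S + g (insert v S))"
proof -
  have "inj_on (insert v) (Pow W)"
    using assms(2) by (auto simp: inj_on_def)
  moreover have "Pow W \<inter> insert v ` Pow W = {}"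
    using assms(2) by auto
  ultimately show ?thesis
    using assms(1) by (simp add: Pow_insert sum.union_disjoint sum.reindex sum.distrib)
qed

text \<open>An assignment on \<open>W\<close> is encoded by the set on which it is true, so that the
  sum over all of them runs over \<open>Pow W\<close>.\<close>

definition overlay :: "'v set \<Rightarrow> 'v set \<Rightarrow> ('v \<Rightarrow> bool) \<Rightarrow> 'v \<Rightarrow> bool" where
  "overlay W S \<sigma> = (\<lambda>v. if v \<in> W then v \<in> S else \<sigma> v)"

lemma ginibre_cone_sum_out_set:
  assumes "finite W" and "ginibre_cone (V \<union> W) K" and "V \<inter> W = {}"
  shows "ginibre_cone V (\<lambda>\<sigma> \<tau>. \<Sum>S\<in>Pow W. \<Sum>T\<in>Pow W. K (overlay W S \<sigma>) (overlay W T \<tau>))"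
  using assms
proof (induction W arbitrary: K rule: finite_induct)
  case empty
  then show ?case by (simp add: overlay_def)
next
  case (insert w W)
  let ?L = "\<lambda>\<sigma> \<tau>. \<Sum>b\<in>UNIV. \<Sum>c\<in>UNIV. K (\<sigma>(w := b)) (\<tau>(w := c))"
  have upd: "overlay (insert w W) S \<sigma> = (overlay W S \<sigma>)(w := False)"
    "overlay (insert w W) (insert w S) \<sigma> = (overlay W S \<sigma>)(w := True)" if "S \<in> Pow W" for S \<sigma>
    using insert(2) that by (auto simp: overlay_def fun_eq_iff)
  have "ginibre_cone (V \<union> W) ?L"
    using insert by (intro ginibre_cone_sum_out) auto
  then have "ginibre_cone V (\<lambda>\<sigma> \<tau>. \<Sum>S\<in>Pow W. \<Sum>T\<in>Pow W. ?L (overlay W S \<sigma>) (overlay W T \<tau>))"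
    using insert.IH[of ?L] insert.prems by blast
  moreover have "(\<Sum>S\<in>Pow (insert w W). \<Sum>T\<in>Pow (insert w W).
      K (overlay (insert w W) S \<sigma>) (overlay (insert w W) T \<tau>)) =
    (\<Sum>S\<in>Pow W. \<Sum>T\<in>Pow W. ?L (overlay W S \<sigma>) (overlay W T \<tau>))" for \<sigma> \<tau>
    unfolding sum_Pow_insert[OF insert(1,2)] sum.distrib[symmetric]
  proof (intro sum.cong refl)
    fix S T
    assume "S \<in> Pow W" "T \<in> Pow W"
    then show "K (overlay (insert w W) S \<sigma>) (overlay (insert w W) T \<tau>) +
        K (overlay (insert w W) S \<sigma>) (overlay (insert w W) (insert w T) \<tau>) +
        (K (overlay (insert w W) (insert w S) \<sigma>) (overlay (insert w W) T \<tau>) +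
         K (overlay (insert w W) (insert w S) \<sigma>) (overlay (insert w W) (insert w T) \<tau>)) =
        ?L (overlay W S \<sigma>) (overlay W T \<tau>)"
      unfolding upd[OF \<open>S \<in> Pow W\<close>] upd[OF \<open>T \<in> Pow W\<close>] UNIV_bool
      by (simp del: fun_upd_apply)
  qed
  ultimately show ?case by simp
qed

section \<open>Characters of the cube\<close>

lemma finite_cube [simp]: "finite (cube k)"
  using finite_lists_length_eq[of "UNIV :: bool set" k] by (simp add: cube_def)

lemma sum_cube_Suc:
  fixes g :: "bool list \<Rightarrow> 'a::comm_monoid_add"
  shows "(\<Sum>x\<in>cube (Suc k). g x) = (\<Sum>x\<in>cube k. g (x @ [False]) + g (x @ [True]))"
proof -
  have "cube (Suc k) = (\<lambda>x. x @ [False]) ` cube k \<union> (\<lambda>x. x @ [True]) ` cube k"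
  proof (intro equalityI subsetI)
    fix x
    assume "x \<in> cube (Suc k)"
    then show "x \<in> (\<lambda>x. x @ [False]) ` cube k \<union> (\<lambda>x. x @ [True]) ` cube k"
      by (cases x rule: rev_cases; cases "last x") (auto simp: cube_def)
  qed (auto simp: cube_def)
  moreover have "inj_on (\<lambda>x. x @ [b]) (cube k)" for b :: bool
    by (auto simp: inj_on_def)
  moreover have "(\<lambda>x. x @ [False]) ` cube k \<inter> (\<lambda>x. x @ [True]) ` cube k = {}"
    by auto
  ultimately show ?thesis
    by (simp add: sum.union_disjoint sum.reindex sum.distrib)
qed

lemma sum_cube_prod:
  fixes h :: "nat \<Rightarrow> bool \<Rightarrow> 'a::comm_semiring_1"
  shows "(\<Sum>x\<in>cube k. \<Prod>i<k. h i (x ! i)) = (\<Prod>i<k. h i False + h i True)"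
proof (induction k)
  case 0
  show ?case by (simp add: cube_def)
next
  case (Suc k)
  have "(\<Sum>x\<in>cube (Suc k). \<Prod>i<Suc k. h i (x ! i)) =
      (\<Sum>x\<in>cube k. (\<Prod>i<k. h i (x ! i)) * (h k False + h k True))"
    unfolding sum_cube_Suc
  proof (intro sum.cong refl)
    fix x
    assume "x \<in> cube k"
    then have "(\<Prod>i<k. h i ((x @ [b]) ! i)) = (\<Prod>i<k. h i (x ! i))" "(x @ [b]) ! k = b" for b
      by (auto simp: cube_def nth_append intro!: prod.cong)
    then show "(\<Prod>i<Suc k. h i ((x @ [False]) ! i)) + (\<Prod>i<Suc k. h i ((x @ [True]) ! i)) =
        (\<Prod>i<k. h i (x ! i)) * (h k False + h k True)"
      by (simp add: distrib_left)
  qed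
  then show ?case
    by (simp add: Suc.IH sum_distrib_right[symmetric])
qed

text \<open>A Walsh character. In product form its sums over the cube factorise by
  \<open>sum_cube_prod\<close>.\<close>

definition character :: "nat \<Rightarrow> bool list \<Rightarrow> bool list \<Rightarrow> real" where
  "character k d x = (\<Prod>i<k. spin (d ! i \<and> x ! i))"

lemma minus_one_power_weight: "(- 1) ^ weight x = (\<Prod>i<length x. spin (x ! i))"
  by (induction x rule: rev_induct) (auto simp: weight_def nth_append spin_def intro!: prod.cong)

lemma minus_one_power_weight_map2:
  assumes "w \<in> cube k" and "x \<in> cube k"
  shows "(- 1) ^ weight (map2 (\<and>) w x) = character k w x"
  using assms unfolding minus_one_power_weight character_def
  by (auto simp: cube_def intro!: prod.cong)

text \<open>The sum factorises over coordinates, and a coordinate where \<open>x\<close> and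
  \<open>w\<close> differ contributes \<open>1 - 1\<close>.\<close>

lemma character_orthogonality:
  assumes "x \<in> cube k" and "w \<in> cube k"
  shows "(\<Sum>d\<in>cube k. character k d x * character k w d) = (if x = w then 2 ^ k else 0)"
proof -
  have "(\<Sum>d\<in>cube k. character k d x * character k w d) =
      (\<Sum>d\<in>cube k. \<Prod>i<k. (\<lambda>i b. spin (b \<and> x ! i) * spin (w ! i \<and> b)) i (d ! i))"
    by (simp add: character_def prod.distrib)
  also have "\<dots> = (\<Prod>i<k. 1 + spin (x ! i) * spin (w ! i))"
    by (subst sum_cube_prod) simp
  also have "\<dots> = (if x = w then 2 ^ k else 0)"
  proof (cases "x = w")
    case False
    then obtain i where "i < k" "x ! i \<noteq> w ! i"
      using assms by (auto simp: cube_def list_eq_iff_nth_eq)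
    then have "1 + spin (x ! i) * spin (w ! i) = 0"
      by (auto simp: spin_def)
    with \<open>i < k\<close> False show ?thesis
      by (auto intro!: prod_zero)
  qed simp
  finally show ?thesis .
qed

lemma fourier_character:
  assumes "d \<in> cube k"
  shows "fourier k f d = (\<Sum>w\<in>cube k. character k w d * f w) / 2 ^ k"
  using assms by (simp add: fourier_def minus_one_power_weight_map2 cong: sum.cong)

lemma fourier_inversion:
  assumes "x \<in> cube k"
  shows "f x = (\<Sum>d\<in>cube k. character k d x * fourier k f d)"
proof -
  have "(\<Sum>d\<in>cube k. character k d x * fourier k f d) =
      (\<Sum>d\<in>cube k. \<Sum>w\<in>cube k. (character k d x * character k w d) * f w / 2 ^ k)"
    by (simp add: fourier_character sum_distrib_left sum_divide_distrib mult_ac cong: sum.cong)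
  also have "\<dots> = (\<Sum>w\<in>cube k. (\<Sum>d\<in>cube k. character k d x * character k w d) * f w / 2 ^ k)"
    by (subst sum.swap) (simp add: sum_distrib_right sum_divide_distrib)
  also have "\<dots> = (\<Sum>w\<in>cube k. if x = w then f w else 0)"
    using assms by (intro sum.cong refl) (simp add: character_orthogonality)
  also have "\<dots> = f x"
    using assms by (simp add: sum.delta)
  finally show ?thesis ..
qed

text \<open>Complementing flips the sign of the factor at each coordinate set in
  \<open>d\<close>.\<close>

lemma character_complement:
  assumes "d \<in> cube k" and "x \<in> cube k"
  shows "character k d (map Not x) = (- 1) ^ weight d * character k d x"
proof -
  have "(- 1) ^ weight d = (\<Prod>i<k. spin (d ! i))"
    using assms(1) by (simp add: minus_one_power_weight cube_def)
  then show ?thesis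
    using assms(2) by (auto simp: character_def cube_def spin_def prod.distrib[symmetric] intro!: prod.cong)
qed

text \<open>A character indexed by a word instead of a bit vector: multiplying by a spin is
  prepending a letter, and only the parity of each multiplicity matters.\<close>

definition spin_word :: "'v list \<Rightarrow> ('v \<Rightarrow> bool) \<Rightarrow> real" where
  "spin_word A \<sigma> = (\<Prod>a\<leftarrow>A. spin (\<sigma> a))"

lemma spin_word_simps [simp]:
  "spin_word [] \<sigma> = 1" "spin_word (a # A) \<sigma> = spin (\<sigma> a) * spin_word A \<sigma>"
  by (simp_all add: spin_word_def)

lemma spin_word_power:
  fixes k :: nat
  assumes "set A \<subseteq> {..<k}"
  shows "spin_word A \<sigma> = (\<Prod>i<k. spin (\<sigma> i) ^ count_list A i)"
  using assms
proof (induction A)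
  case (Cons a A)
  have "(\<Prod>i<k. spin (\<sigma> i) ^ count_list (a # A) i) =
      (\<Prod>i<k. (if a = i then spin (\<sigma> i) else 1) * spin (\<sigma> i) ^ count_list A i)"
    by (intro prod.cong) auto
  also have "\<dots> = spin (\<sigma> a) * (\<Prod>i<k. spin (\<sigma> i) ^ count_list A i)"
    using Cons.prems by (simp add: prod.distrib)
  finally show ?case
    using Cons by simp
qed simp

lemma sum_spin_word:
  assumes "set A \<subseteq> {..<k}"
  shows "(\<Sum>x\<in>cube k. spin_word A ((!) x)) = (\<Prod>i<k. 1 + (- 1) ^ count_list A i)"
proof -
  have "(\<Sum>x\<in>cube k. spin_word A ((!) x)) =
      (\<Sum>x\<in>cube k. \<Prod>i<k. (\<lambda>i b. spin b ^ count_list A i) i (x ! i))"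
    using assms by (simp add: spin_word_power)
  also have "\<dots> = (\<Prod>i<k. 1 + (- 1) ^ count_list A i)"
    by (subst sum_cube_prod) simp
  finally show ?thesis .
qed

lemma sum_spin_word_nonneg:
  assumes "set A \<subseteq> {..<k}"
  shows "(\<Sum>x\<in>cube k. spin_word A ((!) x)) \<ge> 0"
proof -
  have "(0::real) \<le> 1 + (- 1) ^ n" for n :: nat
    by (cases "even n") auto
  then show ?thesis
    using assms by (simp add: sum_spin_word prod_nonneg)
qed

text \<open>In a word of odd length some letter occurs an odd number of times, and its factor in the
  sum is \<open>1 - 1\<close>.\<close>

lemma sum_spin_word_odd:
  assumes "set A \<subseteq> {..<k}" and "odd (length A)"
  shows "(\<Sum>x\<in>cube k. spin_word A ((!) x)) = 0"
proof -
  have "odd (\<Sum>i<k. count_list A i)"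
    using assms sum_count_set[of A "{..<k}"] by simp
  then obtain i where "i < k" "odd (count_list A i)"
    by (metis dvd_sum lessThan_iff)
  then show ?thesis
    using assms(1) by (auto simp: sum_spin_word intro!: prod_zero bexI[of _ i])
qed

lemma length_filter_nth_upt: "length (filter ((!) d) [0..<length d]) = weight d"
proof -
  have "filter id d = map ((!) d) (filter ((!) d) [0..<length d])"
    by (metis filter_map id_comp map_nth)
  then have "length (filter ((!) d) [0..<length d]) = length (filter id d)"
    by simp
  also have "\<dots> = weight d"
    unfolding weight_def by (induction d) auto
  finally show ?thesis .
qed

lemma character_spin_word:
  "character k d x = spin_word (filter ((!) d) [0..<k]) ((!) x)"
proof -
  have "(\<Prod>i\<leftarrow>xs. spin (d ! i \<and> x ! i)) = spin_word (filter ((!) d) xs) ((!) x)" for xs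
    by (induction xs) auto
  from this[of "[0..<k]"] show ?thesis
    unfolding character_def
    by (subst (asm) prod.distinct_set_conv_list[symmetric]) (auto simp: atLeast0LessThan)
qed

text \<open>The factors are absorbed into the words. An overlap adds one letter to each word; a bond
  splits the sum in two, each part adding two letters to one of the words. The parity of the total
  length is preserved, and what remains is a product of two sums of spin words. The general
  \<open>A\<close> and \<open>B\<close> are needed for this induction.\<close>

lemma sum_ginibre_monomial:
  assumes "set xs \<subseteq> {..<k}" and "set ps \<subseteq> {..<k} \<times> {..<k}"
    and "set A \<subseteq> {..<k}" and "set B \<subseteq> {..<k}"
  defines "m \<equiv> \<Sum>x\<in>cube k. \<Sum>y\<in>cube k.
    spin_word A ((!) x) * spin_word B ((!) y) * ginibre_monomial xs ps ((!) x) ((!) y)"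
  shows "0 \<le> m \<and> (odd (length A + length B) \<longrightarrow> m = 0)"
  using assms(1-4) unfolding m_def
proof (induction xs arbitrary: A B)
  case Nil
  note ps = Nil(2)
  show ?case
    using ps Nil(3,4)
  proof (induction ps arbitrary: A B)
    case Nil
    have "(\<Sum>x\<in>cube k. \<Sum>y\<in>cube k. spin_word A ((!) x) * spin_word B ((!) y)) =
        (\<Sum>x\<in>cube k. spin_word A ((!) x)) * (\<Sum>y\<in>cube k. spin_word B ((!) y))"
      by (simp add: sum_product)
    moreover have "odd (length A) \<or> odd (length B)" if "odd (length A + length B)"
      using that by auto
    ultimately show ?case
      using Nil sum_spin_word_nonneg[of A k] sum_spin_word_nonneg[of B k]
        sum_spin_word_odd[of A k] sum_spin_word_odd[of B k]
      by (auto simp: ginibre_monomial_def)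
  next
    case (Cons p ps)
    obtain a b where p: "p = (a, b)" by (cases p)
    have "(\<Sum>x\<in>cube k. \<Sum>y\<in>cube k. spin_word A ((!) x) * spin_word B ((!) y) *
          ginibre_monomial [] (p # ps) ((!) x) ((!) y)) =
        (\<Sum>x\<in>cube k. \<Sum>y\<in>cube k. spin_word (a # b # A) ((!) x) * spin_word B ((!) y) *
          ginibre_monomial [] ps ((!) x) ((!) y)) +
        (\<Sum>x\<in>cube k. \<Sum>y\<in>cube k. spin_word A ((!) x) * spin_word (a # b # B) ((!) y) *
          ginibre_monomial [] ps ((!) x) ((!) y))"
      unfolding sum.distrib[symmetric]
      by (intro sum.cong refl) (simp add: ginibre_monomial_def bond_def p algebra_simps)
    moreover have "set ps \<subseteq> {..<k} \<times> {..<k}" "a < k" "b < k"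
      using Cons.prems p by auto
    ultimately show ?case
      using Cons.IH[of "a # b # A" B] Cons.IH[of A "a # b # B"] Cons.prems by auto
  qed
next
  case (Cons a xs)
  have "(\<Sum>x\<in>cube k. \<Sum>y\<in>cube k. spin_word A ((!) x) * spin_word B ((!) y) *
        ginibre_monomial (a # xs) ps ((!) x) ((!) y)) =
      (\<Sum>x\<in>cube k. \<Sum>y\<in>cube k. spin_word (a # A) ((!) x) * spin_word (a # B) ((!) y) *
        ginibre_monomial xs ps ((!) x) ((!) y))"
    by (intro sum.cong refl) (simp add: ginibre_monomial_def overlap_def)
  then show ?case
    using Cons.IH[of "a # A" "a # B"] Cons.prems by auto
qed

lemma sum_ginibre_cone:
  assumes "ginibre_cone {..<k} K" and "set A \<subseteq> {..<k}"
  defines "m \<equiv> \<lambda>K. \<Sum>x\<in>cube k. \<Sum>y\<in>cube k. spin_word A ((!) x) * K ((!) x) ((!) y)"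
  shows "0 \<le> m K \<and> (odd (length A) \<longrightarrow> m K = 0)"
  using assms(1)
proof (induction rule: ginibre_cone.induct)
  case (monomial c xs ps)
  have "m (\<lambda>\<sigma> \<tau>. c * ginibre_monomial xs ps \<sigma> \<tau>) = c * m (ginibre_monomial xs ps)"
    unfolding m_def sum_distrib_left by (intro sum.cong refl) simp
  then show ?case
    using sum_ginibre_monomial[OF monomial(2,3) assms(2), of "[]"] monomial(1)
    by (auto simp: m_def)
next
  case (add K L)
  have "m (\<lambda>\<sigma> \<tau>. K \<sigma> \<tau> + L \<sigma> \<tau>) = m K + m L"
    unfolding m_def by (simp add: distrib_left sum.distrib)
  with add.IH show ?case by auto
qed

section \<open>Functions satisfying Ginibre's inequalities\<close>

text \<open>The limit is built in because match-circuits are reached only as limits of Ising models,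
  and because the class has to be closed under limits.\<close>

definition ginibre :: "nat \<Rightarrow> (bool list \<Rightarrow> real) \<Rightarrow> bool" where
  "ginibre k f \<longleftrightarrow> (\<exists>K. (\<forall>m. ginibre_cone {..<k} (K m)) \<and>
     (\<forall>x\<in>cube k. \<forall>y\<in>cube k. (\<lambda>m::nat. K m ((!) x) ((!) y)) \<longlonglongrightarrow> f x * f y))"

lemma ginibre_cong:
  assumes "ginibre k f" and "\<And>x. x \<in> cube k \<Longrightarrow> f x = g x"
  shows "ginibre k g"
  using assms unfolding ginibre_def by simp

text \<open>Each argument of \<open>f\<close> reads one coordinate of the new point, so relabelling
  the kernels suffices. This treats fictitious arguments and permutations together.\<close>

lemma ginibre_reindex:
  assumes "ginibre k f" and "\<And>i. i < k \<Longrightarrow> h i < n"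
    and "\<And>x. x \<in> cube n \<Longrightarrow> e x \<in> cube k \<and> (\<forall>i<k. e x ! i = x ! h i)"
  shows "ginibre n (\<lambda>x. f (e x))"
proof -
  obtain K where K: "\<And>m. ginibre_cone {..<k} (K m)"
    and lim: "\<And>x y. x \<in> cube k \<Longrightarrow> y \<in> cube k \<Longrightarrow> (\<lambda>m. K m ((!) x) ((!) y)) \<longlonglongrightarrow> f x * f y"
    using assms(1) unfolding ginibre_def by blast
  have "ginibre_cone {..<n} (\<lambda>\<sigma> \<tau>. K m (\<lambda>v. \<sigma> (h v)) (\<lambda>v. \<tau> (h v)))" for m
    using assms(2) by (intro ginibre_cone_rename[OF K]) auto
  moreover have "(\<lambda>m. K m (\<lambda>v. x ! h v) (\<lambda>v. y ! h v)) \<longlonglongrightarrow> f (e x) * f (e y)"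
    if "x \<in> cube n" "y \<in> cube n" for x y
  proof -
    have "K m (\<lambda>v. x ! h v) (\<lambda>v. y ! h v) = K m ((!) (e x)) ((!) (e y))" for m
      using assms(3) that by (intro ginibre_cone_cong[OF K]) auto
    then show ?thesis
      using lim[of "e x" "e y"] assms(3) that by simp
  qed
  ultimately show ?thesis
    unfolding ginibre_def by (intro exI[of _ "\<lambda>m \<sigma> \<tau>. K m (\<lambda>v. \<sigma> (h v)) (\<lambda>v. \<tau> (h v))"]) auto
qed

lemma ginibre_mult:
  assumes "ginibre k f" and "ginibre k g"
  shows "ginibre k (\<lambda>x. f x * g x)"
proof -
  obtain K where K: "\<And>m. ginibre_cone {..<k} (K m)"
    and limK: "\<And>x y. x \<in> cube k \<Longrightarrow> y \<in> cube k \<Longrightarrow> (\<lambda>m. K m ((!) x) ((!) y)) \<longlonglongrightarrow> f x * f y"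
    using assms(1) unfolding ginibre_def by blast
  obtain L where L: "\<And>m. ginibre_cone {..<k} (L m)"
    and limL: "\<And>x y. x \<in> cube k \<Longrightarrow> y \<in> cube k \<Longrightarrow> (\<lambda>m. L m ((!) x) ((!) y)) \<longlonglongrightarrow> g x * g y"
    using assms(2) unfolding ginibre_def by blast
  have "(\<lambda>m. K m ((!) x) ((!) y) * L m ((!) x) ((!) y)) \<longlonglongrightarrow> f x * g x * (f y * g y)"
    if "x \<in> cube k" "y \<in> cube k" for x y
    using tendsto_mult[OF limK[OF that] limL[OF that]] by (simp add: mult_ac)
  then show ?thesis
    unfolding ginibre_def
    using ginibre_cone_mult[OF K L] by (intro exI[of _ "\<lambda>m \<sigma> \<tau>. K m \<sigma> \<tau> * L m \<sigma> \<tau>"]) auto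
qed

lemma ginibre_sum_out:
  assumes "ginibre (Suc k) f" and "i \<le> k"
  shows "ginibre k (\<lambda>x. \<Sum>b\<in>UNIV. f (take i x @ b # drop i x))"
proof -
  \<comment> \<open>Position \<open>i\<close> receives the label \<open>k\<close>, which is then
    eliminated; later positions move down by one.\<close>
  let ?h = "\<lambda>j. if j < i then j else if j = i then k else j - 1"
  let ?e = "\<lambda>x (b::bool). take i x @ b # drop i x"
  obtain K where K: "\<And>m. ginibre_cone {..<Suc k} (K m)"
    and lim: "\<And>x y. x \<in> cube (Suc k) \<Longrightarrow> y \<in> cube (Suc k) \<Longrightarrow>
      (\<lambda>m. K m ((!) x) ((!) y)) \<longlonglongrightarrow> f x * f y"
    using assms(1) unfolding ginibre_def by blast
  let ?L = "\<lambda>m \<sigma> \<tau>. \<Sum>b\<in>UNIV. \<Sum>c\<in>UNIV.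
    K m (\<lambda>v. (\<sigma>(k := b)) (?h v)) (\<lambda>v. (\<tau>(k := c)) (?h v))"
  have "ginibre_cone (insert k {..<k}) (\<lambda>\<sigma> \<tau>. K m (\<lambda>v. \<sigma> (?h v)) (\<lambda>v. \<tau> (?h v)))" for m
    using assms(2) by (intro ginibre_cone_rename[OF K]) auto
  from ginibre_cone_sum_out[OF this] have L: "ginibre_cone {..<k} (?L m)" for m
    by simp
  have "(\<lambda>m. ?L m ((!) x) ((!) y)) \<longlonglongrightarrow> (\<Sum>b\<in>UNIV. f (?e x b)) * (\<Sum>c\<in>UNIV. f (?e y c))"
    if x: "x \<in> cube k" and y: "y \<in> cube k" for x y
  proof -
    have nth: "(((!) z)(k := b)) (?h v) = ?e z b ! v" if "z \<in> cube k" "v < Suc k" for z b v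
      using that assms(2) by (auto simp: cube_def nth_append nth_Cons' min_def)
    have e: "?e z b \<in> cube (Suc k)" if "z \<in> cube k" for z b
      using that assms(2) by (auto simp: cube_def)
    have "?L m ((!) x) ((!) y) = (\<Sum>b\<in>UNIV. \<Sum>c\<in>UNIV. K m ((!) (?e x b)) ((!) (?e y c)))" for m
      using x y by (intro sum.cong refl ginibre_cone_cong[OF K] conjI nth) auto
    moreover have "(\<lambda>m. \<Sum>b\<in>UNIV. \<Sum>c\<in>UNIV. K m ((!) (?e x b)) ((!) (?e y c))) \<longlonglongrightarrow>
        (\<Sum>b\<in>UNIV. \<Sum>c\<in>UNIV. f (?e x b) * f (?e y c))"
      using x y by (intro tendsto_sum lim e)
    ultimately show ?thesis
      by (simp add: sum_product)
  qed
  with L show ?thesis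
    unfolding ginibre_def by (intro exI[of _ ?L]) blast
qed

text \<open>A diagonal argument: for each \<open>m\<close>, take an approximant \<open>g\<close> and
  then one kernel from its sequence, both with error below \<open>1 / (m + 1)\<close>. The cube is
  finite, so one kernel serves all pairs of points.\<close>

lemma ginibre_limit:
  assumes "\<And>\<epsilon>. 0 < \<epsilon> \<Longrightarrow> \<exists>g. ginibre k g \<and> (\<forall>x\<in>cube k. \<bar>f x - g x\<bar> < \<epsilon>)"
  shows "ginibre k f"
proof -
  have "\<exists>g K. (\<forall>x\<in>cube k. \<bar>f x - g x\<bar> < \<epsilon>) \<and> ginibre_cone {..<k} K \<and>
      (\<forall>x\<in>cube k. \<forall>y\<in>cube k. \<bar>K ((!) x) ((!) y) - g x * g y\<bar> < \<epsilon>)" if "0 < \<epsilon>" for \<epsilon>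
  proof -
    obtain g where g: "ginibre k g" "\<forall>x\<in>cube k. \<bar>f x - g x\<bar> < \<epsilon>"
      using assms[OF \<open>0 < \<epsilon>\<close>] by blast
    obtain K where K: "\<And>m. ginibre_cone {..<k} (K m)"
      and lim: "\<And>x y. x \<in> cube k \<Longrightarrow> y \<in> cube k \<Longrightarrow> (\<lambda>m. K m ((!) x) ((!) y)) \<longlonglongrightarrow> g x * g y"
      using g(1) unfolding ginibre_def by blast
    have "\<forall>\<^sub>F m in sequentially. \<forall>x\<in>cube k. \<forall>y\<in>cube k. \<bar>K m ((!) x) ((!) y) - g x * g y\<bar> < \<epsilon>"
      using lim \<open>0 < \<epsilon>\<close> by (auto intro!: eventually_ball_finite simp: tendsto_iff dist_real_def)
    then obtain m where "\<forall>x\<in>cube k. \<forall>y\<in>cube k. \<bar>K m ((!) x) ((!) y) - g x * g y\<bar> < \<epsilon>"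
      using eventually_happens sequentially_bot by blast
    with K g(2) show ?thesis by blast
  qed
  then have "\<forall>m. \<exists>g K. (\<forall>x\<in>cube k. \<bar>f x - g x\<bar> < inverse (real (Suc m))) \<and> ginibre_cone {..<k} K \<and>
      (\<forall>x\<in>cube k. \<forall>y\<in>cube k. \<bar>K ((!) x) ((!) y) - g x * g y\<bar> < inverse (real (Suc m)))"
    by simp
  then obtain g K where
    g: "\<And>m x. x \<in> cube k \<Longrightarrow> \<bar>f x - g m x\<bar> < inverse (real (Suc m))" and
    K: "\<And>m. ginibre_cone {..<k} (K m)" and
    gK: "\<And>m x y. x \<in> cube k \<Longrightarrow> y \<in> cube k \<Longrightarrow>
      \<bar>K m ((!) x) ((!) y) - g m x * g m y\<bar> < inverse (real (Suc m))"
    by metis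
  have "(\<lambda>m. K m ((!) x) ((!) y)) \<longlonglongrightarrow> f x * f y" if "x \<in> cube k" "y \<in> cube k" for x y
  proof -
    have "(\<lambda>m. f z - g m z) \<longlonglongrightarrow> 0" if "z \<in> cube k" for z
      by (rule tendsto_0_le[OF LIMSEQ_inverse_real_of_nat, of _ 1])
        (use g[OF that] in \<open>auto intro!: always_eventually less_imp_le\<close>)
    then have lim: "(\<lambda>m. g m z) \<longlonglongrightarrow> f z" if "z \<in> cube k" for z
      using tendsto_diff[OF tendsto_const[of "f z"]] that by fastforce
    have "(\<lambda>m. K m ((!) x) ((!) y) - g m x * g m y) \<longlonglongrightarrow> 0"
      by (rule tendsto_0_le[OF LIMSEQ_inverse_real_of_nat, of _ 1])
        (use gK[OF that] in \<open>auto intro!: always_eventually less_imp_le\<close>)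
    from tendsto_add[OF this tendsto_mult[OF lim[OF that(1)] lim[OF that(2)]]]
    show ?thesis by simp
  qed
  with K show ?thesis
    unfolding ginibre_def by blast
qed

lemma ginibre_EQ: "ginibre 2 (snd EQ)"
proof -
  \<comment> \<open>In spins, equality is
    \<open>(1 + \<sigma>\<^sub>0 \<sigma>\<^sub>1) / 2\<close>; this is the expanded product of the
    two copies, so a constant sequence suffices.\<close>
  let ?K = "\<lambda>\<sigma> \<tau>. (1 / 4) * (1 + overlap 0 \<sigma> \<tau> * overlap 1 \<sigma> \<tau> + bond (0::nat, 1) \<sigma> \<tau>)"
  have K: "ginibre_cone {..<2} ?K"
    by (intro ginibre_cone_mult ginibre_cone_const ginibre_cone.add ginibre_cone_overlap
        ginibre_cone_bond) auto
  have "?K ((!) x) ((!) y) = snd EQ x * snd EQ y" if "x \<in> cube 2" "y \<in> cube 2" for x y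
    using that by (auto simp: EQ_def overlap_def bond_def spin_def)
  with K show ?thesis
    unfolding ginibre_def by (intro exI[of _ "\<lambda>_. ?K"]) auto
qed

section \<open>Closure under the clone operations and limits\<close>

definition ginibre_functions :: "bfun set" where
  "ginibre_functions = {(k, f). (k, f) \<in> \<B> \<and> ginibre k f}"

lemma in_B_iff: "(k, f) \<in> \<B> \<longleftrightarrow> (\<forall>x\<in>cube k. 0 \<le> f x) \<and> f \<in> extensional (cube k)"
  by (auto simp: \<B>_def PiE_def)

lemma ginibre_restrict: "ginibre k f \<Longrightarrow> ginibre k (restrict f (cube k))"
  by (erule ginibre_cong) simp

lemma closed_under_operations_ginibre: "closed_under_operations ginibre_functions"
proof -
  have "fictitious i (k, f) \<in> ginibre_functions"
    if f: "(k, f) \<in> ginibre_functions" and i: "i \<le> k" for k f i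
  proof -
    have "ginibre (Suc k) (\<lambda>x. f (take i x @ drop (Suc i) x))"
      by (rule ginibre_reindex[of k f "\<lambda>j. if j < i then j else Suc j"])
        (use f i in \<open>auto simp: ginibre_functions_def cube_def nth_append\<close>)
    from ginibre_restrict[OF this] show ?thesis
      using f i by (auto simp: ginibre_functions_def fictitious_def in_B_iff cube_def)
  qed
  moreover have "permute_args \<pi> (k, f) \<in> ginibre_functions"
    if f: "(k, f) \<in> ginibre_functions" and \<pi>: "\<pi> permutes {..<k}" for k f \<pi>
  proof -
    have "\<pi> i < k" if "i < k" for i
      using permutes_in_image[OF \<pi>, of i] that by simp
    moreover have "permute_list \<pi> x ! i = x ! \<pi> i" if "x \<in> cube k" "i < k" for x i
      using that \<pi> by (simp add: cube_def permute_list_nth)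
    ultimately have "ginibre k (\<lambda>x. f (permute_list \<pi> x))"
      by (intro ginibre_reindex[of k f \<pi> k "permute_list \<pi>"])
        (use f in \<open>auto simp: ginibre_functions_def cube_def\<close>)
    from ginibre_restrict[OF this] show ?thesis
      using f by (auto simp: ginibre_functions_def permute_args_def in_B_iff cube_def)
  qed
  moreover have "(k, \<lambda>x\<in>cube k. f x * g x) \<in> ginibre_functions"
    if "(k, f) \<in> ginibre_functions" and "(k, g) \<in> ginibre_functions" for k f g
    using that ginibre_restrict[OF ginibre_mult[of k f g]]
    by (auto simp: ginibre_functions_def in_B_iff)
  moreover have "sum_out i (k, f) \<in> ginibre_functions"
    if f: "(k, f) \<in> ginibre_functions" and i: "i < k" for k f i
  proof -
    obtain l where k: "k = Suc l"
      using i by (cases k) auto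
    have "ginibre l (\<lambda>x. \<Sum>b\<in>UNIV. f (take i x @ b # drop i x))"
      by (rule ginibre_sum_out) (use f i k in \<open>auto simp: ginibre_functions_def\<close>)
    from ginibre_restrict[OF this] show ?thesis
      using f i k
      by (auto simp: ginibre_functions_def sum_out_def in_B_iff cube_def intro!: sum_nonneg)
  qed
  ultimately show ?thesis
    unfolding closed_under_operations_def by blast
qed

lemma EQ_ginibre: "EQ \<in> ginibre_functions"
  using ginibre_EQ by (auto simp: EQ_def ginibre_functions_def in_B_iff)

lemma closed_under_limits_ginibre: "closed_under_limits ginibre_functions"
  unfolding closed_under_limits_def
proof (intro allI impI)
  fix h
  assume "limit_of ginibre_functions h"
  moreover obtain k f where h: "h = (k, f)" by (cases h)
  ultimately obtain S where f: "(k, f) \<in> \<B>" and S: "S \<subseteq> ginibre_functions"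
    and approx: "\<And>\<epsilon>. 0 < \<epsilon> \<Longrightarrow> \<exists>g. (k, g) \<in> \<langle>S\<rangle> \<and> Max ((\<lambda>x. \<bar>f x - g x\<bar>) ` cube k) < \<epsilon>"
    by (auto simp: limit_of_def)
  have clone: "\<langle>S\<rangle> \<subseteq> ginibre_functions"
    unfolding clone_def
    using S EQ_ginibre closed_under_operations_ginibre by (intro hull_minimal) auto
  have "ginibre k f"
  proof (rule ginibre_limit)
    fix \<epsilon> :: real
    assume "0 < \<epsilon>"
    from approx[OF this] obtain g
      where g: "(k, g) \<in> \<langle>S\<rangle>" and max: "Max ((\<lambda>x. \<bar>f x - g x\<bar>) ` cube k) < \<epsilon>"
      by blast
    have "\<bar>f x - g x\<bar> \<le> Max ((\<lambda>x. \<bar>f x - g x\<bar>) ` cube k)" if "x \<in> cube k" for x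
      using that by (intro Max_ge) auto
    with max have "\<bar>f x - g x\<bar> < \<epsilon>" if "x \<in> cube k" for x
      using that order_le_less_trans by blast
    then show "\<exists>g. ginibre k g \<and> (\<forall>x\<in>cube k. \<bar>f x - g x\<bar> < \<epsilon>)"
      using g clone by (auto simp: ginibre_functions_def)
  qed
  with f h show "h \<in> ginibre_functions"
    by (simp add: ginibre_functions_def)
qed

section \<open>Membership in SDP\<close>

lemma ginibre_functions_subset_SDP: "ginibre_functions \<subseteq> SDP"
proof clarify
  fix k f
  assume "(k, f) \<in> ginibre_functions"
  then have B: "(k, f) \<in> \<B>" and "ginibre k f"
    by (auto simp: ginibre_functions_def)
  then obtain K where K: "\<And>m. ginibre_cone {..<k} (K m)"
    and lim: "\<And>x y. x \<in> cube k \<Longrightarrow> y \<in> cube k \<Longrightarrow> (\<lambda>m. K m ((!) x) ((!) y)) \<longlonglongrightarrow> f x * f y"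
    unfolding ginibre_def by blast
  have nonneg: "0 \<le> f x" if "x \<in> cube k" for x
    using B that by (simp add: in_B_iff)
  \<comment> \<open>Summing out the second copy leaves this mass as a factor of each Fourier
    coefficient. It can be cancelled unless it is 0, in which case \<open>f\<close> vanishes on the
    cube.\<close>
  define T where "T = (\<Sum>y\<in>cube k. f y)"
  have fourier: "0 \<le> fourier k f d \<and> (odd (weight d) \<longrightarrow> fourier k f d = 0)" if d: "d \<in> cube k" for d
  proof (cases "T = 0")
    case True
    then have "\<forall>x\<in>cube k. f x = 0"
      unfolding T_def using nonneg by (subst (asm) sum_nonneg_eq_0_iff) auto
    then show ?thesis
      using d by (simp add: fourier_character)
  next
    case False
    then have "0 < T"
      unfolding T_def using nonneg by (simp add: order_less_le sum_nonneg)
    define A where "A = filter ((!) d) [0..<k]"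
    have A: "set A \<subseteq> {..<k}" and len: "length A = weight d"
      using d length_filter_nth_upt[of d] by (auto simp: A_def cube_def)
    have "(\<lambda>m. \<Sum>x\<in>cube k. \<Sum>y\<in>cube k. spin_word A ((!) x) * K m ((!) x) ((!) y)) \<longlonglongrightarrow>
        (\<Sum>x\<in>cube k. \<Sum>y\<in>cube k. spin_word A ((!) x) * (f x * f y))"
      by (intro tendsto_sum tendsto_mult tendsto_const lim)
    also have "(\<Sum>x\<in>cube k. \<Sum>y\<in>cube k. spin_word A ((!) x) * (f x * f y)) =
        (\<Sum>x\<in>cube k. spin_word A ((!) x) * f x) * T"
      unfolding T_def sum_product by (simp add: mult_ac)
    also have "(\<Sum>x\<in>cube k. spin_word A ((!) x) * f x) = (\<Sum>x\<in>cube k. character k x d * f x)"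
      unfolding A_def character_spin_word[symmetric] by (simp add: character_def conj_commute)
    also have "\<dots> = fourier k f d * 2 ^ k"
      using d by (simp add: fourier_character)
    finally have l: "(\<lambda>m. \<Sum>x\<in>cube k. \<Sum>y\<in>cube k. spin_word A ((!) x) * K m ((!) x) ((!) y))
        \<longlonglongrightarrow> fourier k f d * 2 ^ k * T" .
    have "0 \<le> fourier k f d * 2 ^ k * T"
      using sum_ginibre_cone[OF K A] by (intro LIMSEQ_le_const[OF l]) auto
    moreover have "fourier k f d * 2 ^ k * T = 0" if "odd (weight d)"
      using l sum_ginibre_cone[OF K A] that len by (simp add: LIMSEQ_const_iff)
    moreover obtain c where "c = 2 ^ k * T" and "0 < c"
      using \<open>0 < T\<close> by simp
    ultimately show ?thesis
      by (auto simp: mult.assoc zero_le_mult_iff)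
  qed
  \<comment> \<open>In the Fourier expansion complementing changes the sign of the odd characters
    only, and their coefficients are 0.\<close>
  have "f x = f (map Not x)" if x: "x \<in> cube k" for x
  proof -
    have x': "map Not x \<in> cube k"
      using x by (simp add: cube_def)
    have "character k d x * fourier k f d = character k d (map Not x) * fourier k f d"
      if "d \<in> cube k" for d
      using fourier[OF that] x that by (cases "odd (weight d)") (auto simp: character_complement)
    then show ?thesis
      unfolding fourier_inversion[OF x, of f] fourier_inversion[OF x', of f] by (intro sum.cong) auto
  qed
  with B fourier show "(k, f) \<in> SDP"
    by (auto simp: SDP_def)
qed

section \<open>Match-circuits as limits of Ising models\<close>

lemma prod_incidence:
  fixes u :: "'v \<Rightarrow> 'a::comm_semiring_1"
  assumes "finite H" and "finite V" and "\<And>e. e \<in> H \<Longrightarrow> e \<subseteq> V"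
  shows "(\<Prod>e\<in>H. \<Prod>v\<in>e. u v) = (\<Prod>v\<in>V. u v ^ card {e \<in> H. v \<in> e})"
proof -
  have "(\<Prod>v\<in>e. u v) = (\<Prod>v\<in>V. if v \<in> e then u v else 1)" if "e \<in> H" for e
    using assms(3)[OF that] assms(2) by (simp add: prod.If_cases Int_absorb1)
  then have "(\<Prod>e\<in>H. \<Prod>v\<in>e. u v) = (\<Prod>e\<in>H. \<Prod>v\<in>V. if v \<in> e then u v else 1)"
    by simp
  also have "\<dots> = (\<Prod>v\<in>V. \<Prod>e\<in>H. if v \<in> e then u v else 1)"
    by (rule prod.swap)
  also have "\<dots> = (\<Prod>v\<in>V. u v ^ card {e \<in> H. v \<in> e})"
    using assms(1) by (simp add: prod.inter_filter[symmetric])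
  finally show ?thesis .
qed

lemma sum_Pow_prod:
  fixes g :: "'v \<Rightarrow> bool \<Rightarrow> 'a::comm_semiring_1"
  assumes "finite W"
  shows "(\<Sum>S\<in>Pow W. \<Prod>v\<in>W. g v (v \<in> S)) = (\<Prod>v\<in>W. g v True + g v False)"
proof -
  have "(\<Prod>v\<in>W. g v (v \<in> S)) = (\<Prod>v\<in>S. g v True) * (\<Prod>v\<in>W - S. g v False)" if "S \<in> Pow W" for S
  proof -
    have "W = S \<union> (W - S)" "finite S"
      using that assms by (auto intro: finite_subset)
    then have "(\<Prod>v\<in>W. g v (v \<in> S)) = (\<Prod>v\<in>S. g v (v \<in> S)) * (\<Prod>v\<in>W - S. g v (v \<in> S))"
      using assms by (metis Diff_disjoint finite_Diff prod.union_disjoint)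
    then show ?thesis by simp
  qed
  then show ?thesis
    using assms by (simp add: prod_add)
qed

text \<open>Expanding the product over edges gives a sum over subgraphs \<open>H\<close>. The extra
  spin at each vertex of \<open>W\<close> makes the sum over that spin cancel unless its degree in
  \<open>H\<close> is odd. Vertices outside \<open>W\<close> keep the fixed values
  \<open>u\<close>.\<close>

lemma ising_odd_subgraphs:
  fixes u :: "'v \<Rightarrow> real" and wt :: "'v set \<Rightarrow> real"
  assumes "finite E" and "finite V" and "W \<subseteq> V" and "\<And>e. e \<in> E \<Longrightarrow> e \<subseteq> V"
  shows "(\<Sum>S\<in>Pow W. (\<Prod>v\<in>W. spin (v \<in> S)) *
      (\<Prod>e\<in>E. 1 + wt e * (\<Prod>v\<in>e. if v \<in> W then \<epsilon> * spin (v \<in> S) else u v))) =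
    (\<Sum>H\<in>Pow E. (\<Prod>e\<in>H. wt e) * (\<Prod>v\<in>V - W. u v ^ card {e \<in> H. v \<in> e}) *
      (\<Prod>v\<in>W. \<epsilon> ^ card {e \<in> H. v \<in> e} * (1 - (- 1) ^ card {e \<in> H. v \<in> e})))"
proof -
  have W: "finite W"
    using assms by (blast intro: finite_subset)
  let ?z = "\<lambda>S v. if v \<in> W then \<epsilon> * spin (v \<in> S) else u v"
  let ?d = "\<lambda>H v. card {e \<in> H. v \<in> e}"
  have prod_z: "(\<Prod>e\<in>H. \<Prod>v\<in>e. ?z S v) =
      (\<Prod>v\<in>V - W. u v ^ ?d H v) * (\<Prod>v\<in>W. (\<epsilon> * spin (v \<in> S)) ^ ?d H v)"
    if "H \<in> Pow E" for H S
  proof -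
    have "(\<Prod>e\<in>H. \<Prod>v\<in>e. ?z S v) = (\<Prod>v\<in>V. ?z S v ^ ?d H v)"
      using that assms by (intro prod_incidence) (auto intro: finite_subset)
    also have "\<dots> = (\<Prod>v\<in>V - W. ?z S v ^ ?d H v) * (\<Prod>v\<in>W. ?z S v ^ ?d H v)"
      using assms(2,3) by (simp only: prod.subset_diff)
    finally show ?thesis by simp
  qed
  have "(\<Sum>S\<in>Pow W. (\<Prod>v\<in>W. spin (v \<in> S)) * (\<Prod>e\<in>E. 1 + wt e * (\<Prod>v\<in>e. ?z S v))) =
      (\<Sum>S\<in>Pow W. \<Sum>H\<in>Pow E. (\<Prod>v\<in>W. spin (v \<in> S)) * ((\<Prod>e\<in>H. wt e) * (\<Prod>e\<in>H. \<Prod>v\<in>e. ?z S v)))"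
    using assms(1)
    by (simp add: add.commute[of 1] prod_add prod.distrib sum_distrib_left)
  also have "\<dots> = (\<Sum>H\<in>Pow E. \<Sum>S\<in>Pow W.
      (\<Prod>v\<in>W. spin (v \<in> S)) * ((\<Prod>e\<in>H. wt e) * (\<Prod>e\<in>H. \<Prod>v\<in>e. ?z S v)))"
    by (rule sum.swap)
  also have "\<dots> = (\<Sum>H\<in>Pow E. (\<Prod>e\<in>H. wt e) * (\<Prod>v\<in>V - W. u v ^ ?d H v) *
      (\<Sum>S\<in>Pow W. \<Prod>v\<in>W. (\<lambda>v b. spin b * (\<epsilon> * spin b) ^ ?d H v) v (v \<in> S)))"
    by (intro sum.cong refl) (simp add: prod_z sum_distrib_left prod.distrib mult_ac)
  also have "\<dots> = (\<Sum>H\<in>Pow E. (\<Prod>e\<in>H. wt e) * (\<Prod>v\<in>V - W. u v ^ ?d H v) *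
      (\<Prod>v\<in>W. \<epsilon> ^ ?d H v * (1 - (- 1) ^ ?d H v)))"
  proof -
    have pow: "spin True * (\<epsilon> * spin True) ^ d + spin False * (\<epsilon> * spin False) ^ d =
        \<epsilon> ^ d * (1 - (- 1) ^ d)" for d
      by (simp add: power_minus[of \<epsilon>] algebra_simps)
    have "(\<Sum>S\<in>Pow W. \<Prod>v\<in>W. (\<lambda>v b. spin b * (\<epsilon> * spin b) ^ ?d H v) v (v \<in> S)) =
        (\<Prod>v\<in>W. \<epsilon> ^ ?d H v * (1 - (- 1) ^ ?d H v))" for H
      using sum_Pow_prod[OF W, of "\<lambda>v b. spin b * (\<epsilon> * spin b) ^ ?d H v"] unfolding pow .
    then show ?thesis
      by (intro sum.cong refl) simp
  qed
  finally show ?thesis .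
qed

text \<open>With \<open>\<epsilon> = 1 / (m + 1)\<close>, the quotient is
  \<open>\<epsilon> ^ (d - 1)\<close> for odd \<open>d\<close> and 0 for even
  \<open>d\<close>.\<close>

lemma tendsto_odd_power:
  "(\<lambda>m. inverse (real (Suc m)) ^ d * (1 - (- 1) ^ d) / (2 * inverse (real (Suc m))))
    \<longlonglongrightarrow> (if d = 1 then 1 else 0)"
proof (cases "even d")
  case True
  then show ?thesis by (auto simp: tendsto_const)
next
  case False
  then obtain c where d: "d = Suc c" "even c"
    by (cases d) auto
  then have "(\<lambda>m. inverse (real (Suc m)) ^ d * (1 - (- 1) ^ d) / (2 * inverse (real (Suc m)))) =
      (\<lambda>m. inverse (real (Suc m)) ^ c)"
    by (simp add: fun_eq_iff)
  moreover have "(\<lambda>m. inverse (real (Suc m)) ^ c) \<longlonglongrightarrow> 0 ^ c"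
    by (intro tendsto_power LIMSEQ_inverse_real_of_nat)
  ultimately show ?thesis
    using d by (auto simp: power_0_left)
qed

text \<open>
  In the high-temperature expansion every vertex of \<open>W\<close> has odd degree, hence contributes at
  least one factor \<open>\<epsilon>\<close>; the leading term counts the subgraphs of degree one on \<open>W\<close>.
\<close>

lemma ising_limit_matchings:
  fixes u :: "'v \<Rightarrow> real" and wt :: "'v set \<Rightarrow> real"
  assumes "finite E" and "finite V" and "W \<subseteq> V" and "\<And>e. e \<in> E \<Longrightarrow> e \<subseteq> V"
  shows "(\<lambda>m. (\<Sum>S\<in>Pow W. (\<Prod>v\<in>W. spin (v \<in> S)) *
      (\<Prod>e\<in>E. 1 + wt e * (\<Prod>v\<in>e. if v \<in> W then inverse (real (Suc m)) * spin (v \<in> S) else u v)))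
        / (2 * inverse (real (Suc m))) ^ card W) \<longlonglongrightarrow>
    (\<Sum>H | H \<subseteq> E \<and> (\<forall>v\<in>W. card {e \<in> H. v \<in> e} = 1).
      (\<Prod>e\<in>H. wt e) * (\<Prod>v\<in>V - W. u v ^ card {e \<in> H. v \<in> e}))"
proof -
  have W: "finite W"
    using assms by (blast intro: finite_subset)
  let ?d = "\<lambda>H v. card {e \<in> H. v \<in> e}"
  let ?c = "\<lambda>H. (\<Prod>e\<in>H. wt e) * (\<Prod>v\<in>V - W. u v ^ ?d H v)"
  let ?\<epsilon> = "\<lambda>m. inverse (real (Suc m))"
  have "(\<lambda>m. \<Sum>H\<in>Pow E. ?c H * (\<Prod>v\<in>W. ?\<epsilon> m ^ ?d H v * (1 - (- 1) ^ ?d H v) / (2 * ?\<epsilon> m))) \<longlonglongrightarrow>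
      (\<Sum>H\<in>Pow E. ?c H * (\<Prod>v\<in>W. if ?d H v = 1 then 1 else 0))"
    by (intro tendsto_sum tendsto_mult tendsto_const tendsto_prod tendsto_odd_power)
  moreover have "(\<Sum>H\<in>Pow E. ?c H * (\<Prod>v\<in>W. ?\<epsilon> m ^ ?d H v * (1 - (- 1) ^ ?d H v) / (2 * ?\<epsilon> m))) =
      (\<Sum>H\<in>Pow E. ?c H * (\<Prod>v\<in>W. ?\<epsilon> m ^ ?d H v * (1 - (- 1) ^ ?d H v))) / (2 * ?\<epsilon> m) ^ card W" for m
    unfolding sum_divide_distrib prod_dividef by simp
  moreover have "(\<Sum>H\<in>Pow E. ?c H * (\<Prod>v\<in>W. if ?d H v = 1 then 1 else 0)) =
      (\<Sum>H | H \<subseteq> E \<and> (\<forall>v\<in>W. ?d H v = 1). ?c H)"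
  proof -
    have "(\<Prod>v\<in>W. if ?d H v = 1 then 1 else 0) = (if \<forall>v\<in>W. ?d H v = 1 then 1 else (0::real))" for H
      using W by (auto intro!: prod_zero)
    then have "(\<Sum>H\<in>Pow E. ?c H * (\<Prod>v\<in>W. if ?d H v = 1 then 1 else 0)) =
        (\<Sum>H\<in>Pow E. if \<forall>v\<in>W. ?d H v = 1 then ?c H else 0)"
      by (intro sum.cong refl) simp
    also have "\<dots> = (\<Sum>H\<in>{H \<in> Pow E. \<forall>v\<in>W. ?d H v = 1}. ?c H)"
      using assms(1) by (intro sum.inter_filter[symmetric]) simp
    finally show ?thesis by simp
  qed
  ultimately show ?thesis
    by (simp add: ising_odd_subgraphs[OF assms])
qed

text \<open>This is the two-copy weight of an Ising model with a spin inserted at each vertex of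
  \<open>W\<close>. Nonnegative couplings give every edge factor nonnegative coefficients in
  overlaps and bonds.\<close>

lemma ginibre_cone_ising:
  assumes "\<And>e. e \<in> E \<Longrightarrow> e \<subseteq> V \<and> card e = 2 \<and> 0 \<le> wt e" and "W \<subseteq> V" and "0 \<le> c"
  shows "ginibre_cone V (\<lambda>\<sigma> \<tau>. c * ((\<Prod>v\<in>W. overlap v \<sigma> \<tau>) *
    (\<Prod>e\<in>E. (1 + wt e * (\<Prod>v\<in>e. spin (\<sigma> v))) * (1 + wt e * (\<Prod>v\<in>e. spin (\<tau> v))))))"
proof (rule ginibre_cone_mult[OF ginibre_cone_const
      ginibre_cone_mult[OF ginibre_cone_prod ginibre_cone_prod]])
  show "ginibre_cone V (overlap v)" if "v \<in> W" for v
    using that assms(2) by (intro ginibre_cone_overlap) auto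
  fix e
  assume "e \<in> E"
  then obtain a b where e: "e = {a, b}" "a \<noteq> b" and ab: "a \<in> V" "b \<in> V" and wt: "0 \<le> wt e"
    using assms(1)[of e] by (auto simp: card_2_iff)
  have "ginibre_cone V (\<lambda>\<sigma> \<tau>. 1 + (wt e * wt e) * (overlap a \<sigma> \<tau> * overlap b \<sigma> \<tau>) +
      wt e * bond (a, b) \<sigma> \<tau>)"
    using ab wt by (intro ginibre_cone.add ginibre_cone_mult ginibre_cone_const
        ginibre_cone_overlap ginibre_cone_bond) auto
  moreover have "1 + (wt e * wt e) * (overlap a \<sigma> \<tau> * overlap b \<sigma> \<tau>) + wt e * bond (a, b) \<sigma> \<tau> =
      (1 + wt e * (\<Prod>v\<in>e. spin (\<sigma> v))) * (1 + wt e * (\<Prod>v\<in>e. spin (\<tau> v)))" for \<sigma> \<tau>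
    using e(2) unfolding e(1) by (simp add: overlap_def bond_def algebra_simps)
  ultimately show "ginibre_cone V
      (\<lambda>\<sigma> \<tau>. (1 + wt e * (\<Prod>v\<in>e. spin (\<sigma> v))) * (1 + wt e * (\<Prod>v\<in>e. spin (\<tau> v))))"
    by simp
qed (use assms(3) in simp)

text \<open>Inversion sums over all terminal patterns, so \<open>H\<close> stays constrained at
  internal vertices only, and the character becomes a product of the spins at the external vertices
  that \<open>H\<close> covers.\<close>

lemma circuit_fourier_inversion:
  assumes circuit: "match_circuit k n E wt"
    and f: "\<And>y. y \<in> cube k \<Longrightarrow> fourier k f y = circuit_value k n E wt y"
    and x: "x \<in> cube k" and u: "\<And>i. i < k \<Longrightarrow> u (External i) = spin (x ! i)"
  shows "f x = (\<Sum>H | H \<subseteq> E \<and> (\<forall>v\<in>Internal ` {..<n}. card {e \<in> H. v \<in> e} = 1).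
    (\<Prod>e\<in>H. wt e) * (\<Prod>v\<in>External ` {..<k}. u v ^ card {e \<in> H. v \<in> e}))"
proof -
  have "E \<subseteq> Pow (External ` {..<k} \<union> Internal ` {..<n})"
    using circuit by (auto simp: match_circuit_def)
  then have E: "finite E"
    by (rule finite_subset) simp
  have ex1: "(\<exists>!e. e \<in> H \<and> v \<in> e) \<longleftrightarrow> card {e \<in> H. v \<in> e} = 1" for H :: "vertex set set" and v
  proof
    assume "\<exists>!e. e \<in> H \<and> v \<in> e"
    then obtain e where "{e \<in> H. v \<in> e} = {e}" by blast
    then show "card {e \<in> H. v \<in> e} = 1" by simp
  next
    assume "card {e \<in> H. v \<in> e} = 1"
    then obtain e where "{e \<in> H. v \<in> e} = {e}"
      by (auto simp: card_1_singleton_iff)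
    then show "\<exists>!e. e \<in> H \<and> v \<in> e"
      by (intro ex1I[of _ e]) blast+
  qed
  let ?M = "{H. H \<subseteq> E \<and> (\<forall>v\<in>Internal ` {..<n}. card {e \<in> H. v \<in> e} = 1)}"
  have M: "finite ?M"
    using E by (auto intro: finite_subset[of _ "Pow E"])
  \<comment> \<open>The only terminal pattern compatible with \<open>H\<close>; it collapses the sum
    over \<open>y\<close>.\<close>
  let ?y = "\<lambda>H. map (\<lambda>i. terminal E i \<in> H) [0..<k]"
  have sum_y: "(\<Sum>y\<in>cube k. if \<forall>i<k. terminal E i \<in> H \<longleftrightarrow> y ! i then g y else 0) = g (?y H)"
    for H and g :: "bool list \<Rightarrow> real"
  proof -
    have "(\<forall>i<k. terminal E i \<in> H \<longleftrightarrow> y ! i) \<longleftrightarrow> y = ?y H" if "y \<in> cube k" for y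
      using that by (auto simp: cube_def list_eq_iff_nth_eq)
    then have "(\<Sum>y\<in>cube k. if \<forall>i<k. terminal E i \<in> H \<longleftrightarrow> y ! i then g y else 0) =
        (\<Sum>y\<in>cube k. if y = ?y H then g y else 0)"
      by (intro sum.cong) auto
    also have "\<dots> = g (?y H)"
    proof -
      have "?y H \<in> cube k"
        by (simp add: cube_def)
      then show ?thesis
        by simp
    qed
    finally show ?thesis .
  qed
  have char: "character k (?y H) x = (\<Prod>v\<in>External ` {..<k}. u v ^ card {e \<in> H. v \<in> e})"
    if "H \<subseteq> E" for H
  proof -
    have "spin (?y H ! i \<and> x ! i) = u (External i) ^ card {e \<in> H. External i \<in> e}" if "i < k" for i
    proof -
      have ex: "\<exists>!e. e \<in> E \<and> External i \<in> e"
        using circuit that by (simp add: match_circuit_def)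
      then have t: "terminal E i \<in> E \<and> External i \<in> terminal E i"
        unfolding terminal_def by (rule theI')
      with ex have uniq: "e = terminal E i" if "e \<in> E" "External i \<in> e" for e
        using that by blast
      \<comment> \<open>An external vertex lies on one edge of \<open>E\<close>, so the exponent of
        its spin is 0 or 1.\<close>
      have "{e \<in> H. External i \<in> e} = (if terminal E i \<in> H then {terminal E i} else {})"
        using t uniq \<open>H \<subseteq> E\<close> by auto
      then show ?thesis
        using that by (simp add: u)
    qed
    then show ?thesis
      unfolding character_def by (subst prod.reindex) (auto simp: inj_on_def)
  qed
  have "f x = (\<Sum>y\<in>cube k. character k y x * circuit_value k n E wt y)"
    using f fourier_inversion[OF x, of f] by simp
  also have "\<dots> = (\<Sum>y\<in>cube k. \<Sum>H\<in>?M.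
      if \<forall>i<k. terminal E i \<in> H \<longleftrightarrow> y ! i then character k y x * (\<Prod>e\<in>H. wt e) else 0)"
  proof (intro sum.cong refl)
    fix y :: "bool list"
    have "circuit_value k n E wt y =
        (\<Sum>H\<in>{H \<in> ?M. \<forall>i<k. terminal E i \<in> H \<longleftrightarrow> y ! i}. \<Prod>e\<in>H. wt e)"
      unfolding circuit_value_def ex1 by (intro sum.cong) auto
    also have "\<dots> = (\<Sum>H\<in>?M. if \<forall>i<k. terminal E i \<in> H \<longleftrightarrow> y ! i then \<Prod>e\<in>H. wt e else 0)"
      using M by (rule sum.inter_filter)
    finally show "character k y x * circuit_value k n E wt y = (\<Sum>H\<in>?M.
        if \<forall>i<k. terminal E i \<in> H \<longleftrightarrow> y ! i then character k y x * (\<Prod>e\<in>H. wt e) else 0)"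
      by (simp add: sum_distrib_left if_distrib cong: if_cong)
  qed
  also have "\<dots> = (\<Sum>H\<in>?M. character k (?y H) x * (\<Prod>e\<in>H. wt e))"
    by (subst sum.swap) (simp only: sum_y)
  also have "\<dots> = (\<Sum>H\<in>?M. (\<Prod>e\<in>H. wt e) * (\<Prod>v\<in>External ` {..<k}. u v ^ card {e \<in> H. v \<in> e}))"
    by (intro sum.cong refl) (simp add: char)
  finally show ?thesis .
qed

lemma match_circuit_ginibre:
  assumes circuit: "match_circuit k n E wt"
    and f: "\<And>y. y \<in> cube k \<Longrightarrow> fourier k f y = circuit_value k n E wt y"
  shows "ginibre k f"
proof -
  define W where "W = Internal ` {..<n}"
  define U where "U = External ` {..<k}"
  have fin: "finite W" "finite U" "finite (U \<union> W)" and disj: "U \<inter> W = {}"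
    by (auto simp: U_def W_def)
  have diff: "(U \<union> W) - W = U"
    using disj by auto
  have edge: "e \<subseteq> U \<union> W \<and> card e = 2 \<and> 0 \<le> wt e" if "e \<in> E" for e
  proof -
    have "0 \<le> wt e"
      using circuit that by (cases "e \<in> terminal E ` {..<k}")
        (force simp: match_circuit_def intro: less_imp_le)+
    then show ?thesis
      using circuit that by (simp add: match_circuit_def U_def W_def)
  qed
  have "E \<subseteq> Pow (U \<union> W)"
    using edge by auto
  with fin have E: "finite E"
    by (meson finite_Pow_iff finite_subset)
  let ?\<epsilon> = "\<lambda>m. inverse (real (Suc m))"
  \<comment> \<open>Only the values at external vertices matter: the spins on \<open>W\<close> are
    supplied by the summation sets.\<close>
  define h where "h v = (case v of External i \<Rightarrow> i | Internal j \<Rightarrow> j)" for v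
  define P where "P m x = (\<Sum>S\<in>Pow W. (\<Prod>v\<in>W. spin (v \<in> S)) *
      (\<Prod>e\<in>E. 1 + wt e * (\<Prod>v\<in>e. if v \<in> W then ?\<epsilon> m * spin (v \<in> S) else spin (x ! h v))))
        / (2 * ?\<epsilon> m) ^ card W" for m x
  have P_lim: "(\<lambda>m. P m x) \<longlonglongrightarrow> f x" if x: "x \<in> cube k" for x
  proof -
    have "(\<lambda>m. P m x) \<longlonglongrightarrow> (\<Sum>H | H \<subseteq> E \<and> (\<forall>v\<in>W. card {e \<in> H. v \<in> e} = 1).
        (\<Prod>e\<in>H. wt e) * (\<Prod>v\<in>(U \<union> W) - W. spin (x ! h v) ^ card {e \<in> H. v \<in> e}))"
      unfolding P_def using E fin edge by (intro ising_limit_matchings) auto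
    moreover have "(\<Sum>H | H \<subseteq> E \<and> (\<forall>v\<in>W. card {e \<in> H. v \<in> e} = 1).
        (\<Prod>e\<in>H. wt e) * (\<Prod>v\<in>(U \<union> W) - W. spin (x ! h v) ^ card {e \<in> H. v \<in> e})) = f x"
      unfolding diff unfolding U_def W_def
      using circuit_fourier_inversion[OF circuit f x, of "\<lambda>v. spin (x ! h v)"]
      by (simp add: h_def)
    ultimately show ?thesis by simp
  qed
  \<comment> \<open>The factor \<open>\<epsilon>\<close> per internal endpoint moves from the spins
    into the couplings, which makes \<open>P\<close> a sum of genuine Ising weights. Below,
    \<open>K\<close> is the summand of the product of two copies of \<open>P\<close>, hence its
    squared normalisation.\<close>
  define w where "w m e = wt e * ?\<epsilon> m ^ card (e \<inter> W)" for m e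
  define K where "K m \<sigma> \<tau> = (1 / (2 * ?\<epsilon> m) ^ card W)\<^sup>2 * ((\<Prod>v\<in>W. overlap v \<sigma> \<tau>) *
    (\<Prod>e\<in>E. (1 + w m e * (\<Prod>v\<in>e. spin (\<sigma> v))) * (1 + w m e * (\<Prod>v\<in>e. spin (\<tau> v)))))"
    for m and \<sigma> \<tau> :: "vertex \<Rightarrow> bool"
  define L where "L m \<sigma> \<tau> = (\<Sum>S\<in>Pow W. \<Sum>T\<in>Pow W.
    K m (overlay W S (\<lambda>v. \<sigma> (h v))) (overlay W T (\<lambda>v. \<tau> (h v))))" for m and \<sigma> \<tau> :: "nat \<Rightarrow> bool"
  have "ginibre_cone (U \<union> W) (K m)" for m
    unfolding K_def using edge by (intro ginibre_cone_ising) (auto simp: w_def)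
  from ginibre_cone_rename[OF ginibre_cone_sum_out_set[OF fin(1) this disj], of h "{..<k}"]
  have L: "ginibre_cone {..<k} (L m)" for m
    by (simp add: L_def[abs_def] U_def h_def image_image)
  have "L m ((!) x) ((!) y) = P m x * P m y" for m x y
  proof -
    let ?s = "\<lambda>x S. overlay W S (\<lambda>v. x ! h v)"
    let ?c = "1 / (2 * ?\<epsilon> m) ^ card W"
    have prod_e: "w m e * (\<Prod>v\<in>e. spin (?s x S v)) =
        wt e * (\<Prod>v\<in>e. if v \<in> W then ?\<epsilon> m * spin (v \<in> S) else spin (x ! h v))"
      if "e \<in> E" for e S x
    proof -
      have e: "finite e"
        using edge[OF that] by (auto intro: card_ge_0_finite)
      have "(\<Prod>v\<in>e. if v \<in> W then ?\<epsilon> m * spin (v \<in> S) else spin (x ! h v)) =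
          (\<Prod>v\<in>e. (if v \<in> W then ?\<epsilon> m else 1) * spin (?s x S v))"
        by (intro prod.cong refl) (simp add: overlay_def)
      also have "\<dots> = ?\<epsilon> m ^ card (e \<inter> W) * (\<Prod>v\<in>e. spin (?s x S v))"
        using e by (simp add: prod.distrib prod.If_cases)
      finally show ?thesis
        by (simp add: w_def mult_ac)
    qed
    define F where "F x S = ?c * ((\<Prod>v\<in>W. spin (v \<in> S)) * (\<Prod>e\<in>E. 1 + w m e * (\<Prod>v\<in>e. spin (?s x S v))))"
      for x S
    have F: "P m x = (\<Sum>S\<in>Pow W. F x S)" for x
      unfolding P_def F_def sum_divide_distrib
      by (intro sum.cong refl) (simp add: prod_e cong: prod.cong)
    have "K m (?s x S) (?s y T) = F x S * F y T" for S T
    proof -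
      have "(\<Prod>v\<in>W. overlap v (?s x S) (?s y T)) = (\<Prod>v\<in>W. spin (v \<in> S)) * (\<Prod>v\<in>W. spin (v \<in> T))"
        by (simp add: overlap_def overlay_def prod.distrib)
      then show ?thesis
        unfolding K_def F_def prod.distrib power2_eq_square by (simp only: mult_ac)
    qed
    then show ?thesis
      unfolding L_def F sum_product by simp
  qed
  then have "(\<lambda>m. L m ((!) x) ((!) y)) \<longlonglongrightarrow> f x * f y" if "x \<in> cube k" "y \<in> cube k" for x y
    using tendsto_mult[OF P_lim P_lim] that by simp
  with L show ?thesis
    unfolding ginibre_def by blast
qed

lemma M_subset_ginibre: "\<M> \<subseteq> ginibre_functions"
proof clarify
  fix k f
  assume "(k, f) \<in> \<M>"
  then obtain n E wt where "(k, f) \<in> \<B>" and "match_circuit k n E wt"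
    and "\<forall>y\<in>cube k. fourier k f y = circuit_value k n E wt y"
    unfolding \<M>_def implemented_def by blast
  then show "(k, f) \<in> ginibre_functions"
    using match_circuit_ginibre[of k n E wt f] by (simp add: ginibre_functions_def)
qed

section \<open>The 4-ary parity function\<close>

definition even_parity :: bfun where
  "even_parity = (4, \<lambda>x\<in>cube 4. if even (weight x) then 1 else 0)"

lemma cube_4E:
  assumes "x \<in> cube 4"
  obtains a b c d where "x = [a, b, c, d]"
  using assms by (auto simp: cube_def length_Suc_conv numeral_eq_Suc)

text \<open>Even parity is half the sum of the characters of 0000 and 1111, so its transform is 1/2
  at these two points and 0 elsewhere.\<close>

lemma even_parity_SDP: "even_parity \<in> SDP"
proof -
  define f where "f = snd even_parity"
  have fourier: "0 \<le> fourier 4 f d \<and> (odd (weight d) \<longrightarrow> fourier 4 f d = 0)" if d: "d \<in> cube 4" for d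
  proof -
    have "fourier 4 f d = (\<Sum>w\<in>cube 4. character 4 w d * ((1 + (- 1) ^ weight w) / 2)) / 2 ^ 4"
      unfolding fourier_character[OF d]
      by (intro arg_cong[where f = "\<lambda>s. s / 2 ^ 4"] sum.cong refl) (auto simp: f_def even_parity_def)
    also have "\<dots> = ((\<Sum>w\<in>cube 4. \<Prod>i<4. (\<lambda>i b. spin (b \<and> d ! i)) i (w ! i)) +
        (\<Sum>w\<in>cube 4. \<Prod>i<4. (\<lambda>i b. spin (b \<and> d ! i) * spin b) i (w ! i))) / 2 ^ 5"
    proof -
      have "character 4 w d * ((1 + (- 1) ^ weight w) / 2) =
          ((\<Prod>i<4. spin (w ! i \<and> d ! i)) + (\<Prod>i<4. spin (w ! i \<and> d ! i) * spin (w ! i))) / 2"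
        if "w \<in> cube 4" for w
        using that by (simp add: character_def prod.distrib minus_one_power_weight cube_def distrib_left)
      then show ?thesis
        by (simp add: sum.distrib[symmetric] sum_divide_distrib[symmetric])
    qed
    also have "\<dots> = ((\<Prod>i<4. 1 + spin (d ! i)) + (\<Prod>i<4. 1 - spin (d ! i))) / 2 ^ 5"
      by (subst sum_cube_prod, subst sum_cube_prod) simp
    finally have "fourier 4 f d = ((\<Prod>i<4. 1 + spin (d ! i)) + (\<Prod>i<4. 1 - spin (d ! i))) / 2 ^ 5" .
    moreover obtain p q r s where "d = [p, q, r, s]"
      using d by (rule cube_4E)
    moreover have "{..<4} = {0, 1, 2, 3::nat}"
      by auto
    ultimately show ?thesis
      by (cases p; cases q; cases r; cases s) (simp_all add: weight_def)
  qed
  have "\<forall>x\<in>cube 4. f x = f (map Not x)"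
  proof
    fix x
    assume "x \<in> cube 4"
    then obtain a b c d where "x = [a, b, c, d]" by (rule cube_4E)
    then show "f x = f (map Not x)"
      by (auto simp: f_def even_parity_def cube_def weight_def)
  qed
  moreover have "(4, f) \<in> \<B>" and even_parity: "even_parity = (4, f)"
    by (auto simp: f_def even_parity_def in_B_iff)
  ultimately show ?thesis
    unfolding SDP_def even_parity using fourier by (simp only: mem_Collect_eq prod.case) force
qed

section \<open>A linear functional separating parity from the cone\<close>

definition twist :: "(nat \<Rightarrow> bool) \<Rightarrow> bool list \<Rightarrow> bool list" where
  "twist r x = map (\<lambda>i. x ! i \<noteq> r i) [0..<4]"

lemma twist_cube: "twist r x \<in> cube 4"
  by (simp add: twist_def cube_def)

text \<open>
  Nonnegative on the cone: a nontrivial bond \<open>(i, j)\<close> vanishes under all but one of the three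
  balanced bipartitions of the vertices, the twists by \<open>{0, a}\<close>.
\<close>

definition split_functional :: "((nat \<Rightarrow> bool) \<Rightarrow> (nat \<Rightarrow> bool) \<Rightarrow> real) \<Rightarrow> real" where
  "split_functional K = (\<Sum>x\<in>cube 4. spin_word [0, 1, 2, 3] ((!) x) *
     ((K ((!) x) ((!) (twist (\<lambda>_. False) x)) + K ((!) x) ((!) (twist (\<lambda>_. True) x))) -
      (\<Sum>a\<in>{1, 2, 3}. K ((!) x) ((!) (twist (\<lambda>i. i = 0 \<or> i = a) x)) +
        K ((!) x) ((!) (twist (\<lambda>i. \<not> (i = 0 \<or> i = a)) x)))))"

text \<open>At a pair \<open>x\<close>, \<open>twist r x\<close> an overlap depends on
  \<open>r\<close> alone, and a bond is \<open>\<sigma>\<^sub>a \<sigma>\<^sub>b\<close> times a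
  factor in \<open>r\<close>. This collects the dependence of a monomial on \<open>r\<close>; the
  rest is a spin word in \<open>x\<close>.\<close>

definition twist_factor :: "'v list \<Rightarrow> ('v \<times> 'v) list \<Rightarrow> ('v \<Rightarrow> bool) \<Rightarrow> real" where
  "twist_factor xs ps r = spin_word xs r * (\<Prod>p\<leftarrow>ps. 1 + spin (r (fst p)) * spin (r (snd p)))"

lemma twist_factor_Not: "twist_factor xs ps (\<lambda>i. \<not> r i) = (- 1) ^ length xs * twist_factor xs ps r"
proof -
  have "spin_word xs (\<lambda>i. \<not> r i) = (- 1) ^ length xs * spin_word xs r"
    by (induction xs) auto
  then show ?thesis
    by (simp add: twist_factor_def)
qed

lemma twist_factor_le: "twist_factor xs ps r \<le> 2 ^ length ps"
proof -
  have "\<bar>spin_word xs r\<bar> = 1"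
    by (induction xs) (auto simp: abs_mult spin_def)
  moreover have "\<bar>\<Prod>p\<leftarrow>ps. 1 + spin (r (fst p)) * spin (r (snd p))\<bar> \<le> 2 ^ length ps"
  proof (induction ps)
    case (Cons p ps)
    have "\<bar>1 + spin (r (fst p)) * spin (r (snd p))\<bar> \<le> 2"
      by (auto simp: spin_def)
    from mult_mono[OF this Cons.IH] show ?case
      by (simp add: abs_mult)
  qed simp
  ultimately have "\<bar>twist_factor xs ps r\<bar> \<le> 2 ^ length ps"
    by (simp add: twist_factor_def abs_mult)
  then show ?thesis by simp
qed

lemma twist_factor_eq_0:
  assumes "(i, j) \<in> set ps" and "r i \<noteq> r j"
  shows "twist_factor xs ps r = 0"
proof -
  have "1 + spin (r (fst (i, j))) * spin (r (snd (i, j))) = 0"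
    using assms(2) by (auto simp: spin_def)
  then have "0 \<in> set (map (\<lambda>p. 1 + spin (r (fst p)) * spin (r (snd p))) ps)"
    using assms(1) by (metis (mono_tags, lifting) image_eqI set_map)
  then show ?thesis
    by (simp add: twist_factor_def prod_list_zero_iff)
qed

lemma ginibre_monomial_twist:
  assumes "set xs \<subseteq> {..<4}" and "set ps \<subseteq> {..<4} \<times> {..<4}"
  shows "ginibre_monomial xs ps ((!) x) ((!) (twist r x)) =
    twist_factor xs ps r * spin_word (concat (map (\<lambda>p. [fst p, snd p]) ps)) ((!) x)"
proof -
  have twist: "spin (twist r x ! i) = spin (x ! i) * spin (r i)" if "i < 4" for i
    using that by (auto simp: twist_def spin_def)
  have "(\<Prod>a\<leftarrow>xs. overlap a ((!) x) ((!) (twist r x))) = spin_word xs r"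
    using assms(1) by (induction xs) (auto simp: overlap_def twist)
  moreover have "(\<Prod>p\<leftarrow>ps. bond p ((!) x) ((!) (twist r x))) =
      (\<Prod>p\<leftarrow>ps. 1 + spin (r (fst p)) * spin (r (snd p))) *
      spin_word (concat (map (\<lambda>p. [fst p, snd p]) ps)) ((!) x)"
    using assms(2) by (induction ps) (auto simp: bond_def twist algebra_simps)
  ultimately show ?thesis
    by (simp add: ginibre_monomial_def twist_factor_def)
qed

lemma split_functional_monomial:
  assumes xs: "set xs \<subseteq> {..<4}" and ps: "set ps \<subseteq> {..<4} \<times> {..<4}"
  shows "0 \<le> split_functional (ginibre_monomial xs ps)"
proof -
  let ?g = "twist_factor xs ps"
  let ?r = "\<lambda>a i. i = 0 \<or> i = a"
  let ?A = "concat (map (\<lambda>p. [fst p, snd p]) ps)"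
  define N where "N = (\<Sum>x\<in>cube 4. spin_word ([0, 1, 2, 3] @ ?A) ((!) x))"
  have A: "set ([0, 1, 2, 3] @ ?A) \<subseteq> {..<4}"
    using ps by auto
  have "split_functional (ginibre_monomial xs ps) =
      (\<Sum>x\<in>cube 4. spin_word ([0, 1, 2, 3] @ ?A) ((!) x) *
        (?g (\<lambda>_. False) + ?g (\<lambda>_. True) - (\<Sum>a\<in>{1, 2, 3}. ?g (?r a) + ?g (\<lambda>i. \<not> ?r a i))))"
    unfolding split_functional_def ginibre_monomial_twist[OF xs ps]
    by (intro sum.cong refl) (simp add: spin_word_def algebra_simps)
  \<comment> \<open>Each twist is paired with its complement, which contributes the same factor up
    to \<open>(- 1) ^ length xs\<close>; the trivial twist attains the maximum
    \<open>2 ^ length ps\<close>.\<close>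
  also have "\<dots> = N * ((1 + (- 1) ^ length xs) * (2 ^ length ps - (\<Sum>a\<in>{1, 2, 3}. ?g (?r a))))"
  proof -
    have "?g (\<lambda>_. False) = 2 ^ length ps"
    proof -
      have "spin_word xs (\<lambda>_. False) = 1"
        by (induction xs) auto
      moreover have "(\<Prod>p\<leftarrow>ps. 1 + spin False * spin False) = 2 ^ length ps"
        by (induction ps) auto
      ultimately show ?thesis by (simp add: twist_factor_def)
    qed
    then show ?thesis
      using twist_factor_Not[of xs ps "\<lambda>_. False"]
      unfolding N_def sum_distrib_right[symmetric] twist_factor_Not[of xs ps "?r _"]
      by (simp add: algebra_simps)
  qed
  also have "0 \<le> \<dots>"
  proof (cases "\<exists>i j. (i, j) \<in> set ps \<and> i \<noteq> j")
    case True
    then obtain i j where ij: "(i, j) \<in> set ps" "i \<noteq> j" by blast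
    with ps have lt: "i < 4" "j < 4" by auto
    define G where "G a = ?g (?r a)" for a
    have G: "G a \<le> 2 ^ length ps" "?r a i \<noteq> ?r a j \<Longrightarrow> G a = 0" for a
      unfolding G_def by (rule twist_factor_le, rule twist_factor_eq_0[OF ij(1)])
    have "i \<in> {0, 1, 2, 3}" "j \<in> {0, 1, 2, 3}"
      using lt by auto
    \<comment> \<open>Only one of the three bipartitions leaves \<open>i\<close> and
      \<open>j\<close> on the same side, so two of the summands vanish.\<close>
    then have "G 1 + G 2 + G 3 \<le> 2 ^ length ps"
      using G(1)[of 1] G(1)[of 2] G(1)[of 3] G(2)[of 1] G(2)[of 2] G(2)[of 3] ij(2)
      by (elim insertE emptyE) simp_all
    then have "(\<Sum>a\<in>{1, 2, 3}. ?g (?r a)) \<le> 2 ^ length ps"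
      by (simp add: G_def)
    moreover have "0 \<le> N"
      unfolding N_def by (rule sum_spin_word_nonneg[OF A])
    moreover have "0 \<le> 1 + (- 1 :: real) ^ length xs"
      by (cases "even (length xs)") auto
    ultimately show ?thesis by simp
  next
    \<comment> \<open>All bonds are loops, so their spins in \<open>x\<close> square to 1 and the
      weight by the product of the four spins makes \<open>N\<close> vanish.\<close>
    case False
    then have "\<forall>p\<in>set ps. fst p = snd p"
      by auto
    then have "spin_word ?A \<sigma> = 1" for \<sigma>
      by (induction ps) auto
    then have "N = (\<Sum>x\<in>cube 4. spin_word [0, 1, 2, 3] ((!) x))"
      by (simp add: N_def spin_word_def)
    also have "\<dots> = (\<Prod>i<4::nat. 1 + (- 1) ^ count_list [0, 1, 2, 3] i)"
      by (rule sum_spin_word) auto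
    also have "\<dots> = 0"
      by (intro prod_zero) (auto intro!: bexI[of _ 0])
    finally show ?thesis by simp
  qed
  finally show ?thesis .
qed

lemma split_functional_nonneg:
  assumes "ginibre_cone {..<4} K"
  shows "0 \<le> split_functional K"
  using assms
proof (induction rule: ginibre_cone.induct)
  case (monomial c xs ps)
  have "split_functional (\<lambda>\<sigma> \<tau>. c * ginibre_monomial xs ps \<sigma> \<tau>) =
      c * split_functional (ginibre_monomial xs ps)"
    unfolding split_functional_def sum_distrib_left
    by (intro sum.cong refl) (simp add: algebra_simps)
  then show ?case
    using split_functional_monomial[OF monomial(2,3)] monomial(1) by simp
next
  case (add K L)
  have "split_functional (\<lambda>\<sigma> \<tau>. K \<sigma> \<tau> + L \<sigma> \<tau>) = split_functional K + split_functional L"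
    unfolding split_functional_def sum.distrib[symmetric]
    by (intro sum.cong refl) (simp add: algebra_simps)
  with add.IH show ?case by simp
qed

lemma even_parity_not_ginibre: "even_parity \<notin> ginibre_functions"
proof
  define f where "f = snd even_parity"
  assume "even_parity \<in> ginibre_functions"
  then have "ginibre 4 f"
    by (auto simp: ginibre_functions_def even_parity_def f_def)
  then obtain K where K: "\<And>m. ginibre_cone {..<4} (K m)"
    and lim: "\<And>x y. x \<in> cube 4 \<Longrightarrow> y \<in> cube 4 \<Longrightarrow> (\<lambda>m. K m ((!) x) ((!) y)) \<longlonglongrightarrow> f x * f y"
    unfolding ginibre_def by blast
  let ?l = "\<Sum>x\<in>cube 4. spin_word [0, 1, 2, 3] ((!) x) *
     ((f x * f (twist (\<lambda>_. False) x) + f x * f (twist (\<lambda>_. True) x)) -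
      (\<Sum>a\<in>{1, 2, 3}. f x * f (twist (\<lambda>i. i = 0 \<or> i = a) x) +
        f x * f (twist (\<lambda>i. \<not> (i = 0 \<or> i = a)) x)))"
  have "(\<lambda>m. split_functional (K m)) \<longlonglongrightarrow> ?l"
    unfolding split_functional_def
    by (intro tendsto_sum tendsto_mult tendsto_const tendsto_diff tendsto_add lim twist_cube)
  then have "0 \<le> ?l"
    using split_functional_nonneg[OF K] by (intro LIMSEQ_le_const) auto
  \<comment> \<open>At even \<open>x\<close> the product of the spins is 1, and all eight twists
    flip an even number of bits. All values of \<open>f\<close> involved are then 1, and the bracket
    is \<open>2 - 6\<close>.\<close>
  moreover have "?l = (\<Sum>x\<in>cube 4. - 4 * f x)"
  proof (intro sum.cong refl)
    fix x :: "bool list"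
    assume "x \<in> cube 4"
    then obtain a b c d where x: "x = [a, b, c, d]" by (rule cube_4E)
    have upt: "[0..<4] = [0, 1, 2, 3::nat]"
      by (simp add: upt_rec)
    show "spin_word [0, 1, 2, 3] ((!) x) *
        ((f x * f (twist (\<lambda>_. False) x) + f x * f (twist (\<lambda>_. True) x)) -
        (\<Sum>a\<in>{1, 2, 3}. f x * f (twist (\<lambda>i. i = 0 \<or> i = a) x) +
          f x * f (twist (\<lambda>i. \<not> (i = 0 \<or> i = a)) x))) = - 4 * f x"
      unfolding x
      by (cases a; cases b; cases c; cases d)
        (simp_all add: twist_def upt f_def even_parity_def cube_def weight_def)
  qed
  moreover have "[False, False, False, False] \<in> cube 4"
    by (simp add: cube_def)
  then have "0 < (\<Sum>x\<in>cube 4. f x)"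
    by (intro sum_pos2[of _ "[False, False, False, False]"])
      (auto simp: f_def even_parity_def weight_def)
  ultimately show False
    by (simp add: sum_negf sum_distrib_left[symmetric])
qed

theorem theorem8p8:
  shows "\<langle>\<M>\<rangle>\<^sub>\<omega> \<subset> SDP"
proof -
  have "\<langle>\<M>\<rangle>\<^sub>\<omega> \<subseteq> ginibre_functions"
    unfolding omega_clone_def
    using M_subset_ginibre EQ_ginibre closed_under_operations_ginibre closed_under_limits_ginibre
    by (intro hull_minimal) auto
  then show ?thesis
    using ginibre_functions_subset_SDP even_parity_SDP even_parity_not_ginibre by blast
qed

end
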